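(* Let $k$ be a complex parameter and let $\mathcal M$ be the operator in the indeterminates $x_1,\dots,x_n,y_1,\dots,y_m$ $$ \begin{aligned} \mathcal M={}&\sum_{i=1}^n\Big(x_i\frac{\partial}{\partial x_i}\Big)^2-k\sum_{j=1}^m\Big(y_j\frac{\partial}{\partial y_j}\Big)^2+k\sum_{1\le i<j\le n}\frac{x_i+x_j}{x_i-x_j}\Big(x_i\frac{\partial}{\partial x_i}-x_j\frac{\partial}{\partial x_j}\Big)\\ &-\sum_{1\le i<j\le m}\frac{y_i+y_j}{y_i-y_j}\Big(y_i\frac{\partial}{\partial y_i}-y_j\frac{\partial}{\partial y_j}\Big)-\sum_{1\le i\le n,\;1\le j\le m}\frac{x_i+y_j}{x_i-y_j}\Big(x_i\frac{\partial}{\partial x_i}-y_j\frac{\partial}{\partial y_j}\Big). \end{aligned} $$ Then the superanalogs $P_\lambda(x,y;k)$ of the Jack polynomials ($\lambda$ a partition) are eigenfunctions of $\mathcal M$.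
   Context: $P_\lambda(x;k)$ denotes the classical Jack polynomial of the partition $\lambda$ with parameter $k=1/\alpha$, where $\alpha$ is the parameter used in Macdonald's book. For a partition $\mu=(\mu_1,\dots,\mu_l)$ let $S^\mu=S^{\mu_1}\cdots S^{\mu_l}$, where $S^p=\sum_i x_i^p$ is the power sum, and let $P_\lambda(x;k)=\sum_\mu\chi^\lambda_\mu(k)S^\mu$ be the decomposition of the Jack polynomial into products of power sums (in the ring of symmetric functions). Superanalogs of Jack polynomials (Kerov–Okounkov–Olshanski): put $$S^{p,k}=\sum_{1\le i\le n} x_i^p-\frac1k\sum_{1\le j\le m} y_j^p,\qquad S^{\mu,k}=S^{\mu_1,k}\cdots S^{\mu_l,k},$$ and define $P_\lambda(x,y;k)=\sum_\mu\chi^\lambda_\mu(k)\,S^{\mu,k}$.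
   Formalization: In the last sum of M, x_i∂/∂x_i − y_j∂/∂y_j is replaced by x_i∂/∂x_i + k y_j∂/∂y_j: as printed the claim fails for n = m = 1, λ = (1) unless k = −1. Assumed: k ≠ 0 and k is not a pole of any coefficient χ^λ_μ; P_λ(x,y;k) = 0 is not excluded. *)

theory Defs
  imports
    "HOL-Analysis.Analysis"
    "HOL-Library.Multiset"
    "HOL-Library.Poly_Mapping"
    "HOL-Computational_Algebra.Polynomial"
    "HOL-Computational_Algebra.Fraction_Field"
begin

text \<open>A partition is the multiset of its (positive) parts.\<close>

definition is_partition :: "nat multiset \<Rightarrow> bool" where
  "is_partition mu \<longleftrightarrow> 0 \<notin># mu"

definition parts_desc :: "nat multiset \<Rightarrow> nat list" where
  "parts_desc mu = rev (sorted_list_of_multiset mu)"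

definition dominated_by :: "nat multiset \<Rightarrow> nat multiset \<Rightarrow> bool" where
  "dominated_by mu la \<longleftrightarrow>
     sum_mset mu = sum_mset la \<and>
     (\<forall>i. sum_list (take i (parts_desc mu)) \<le> sum_list (take i (parts_desc la)))"

definition z_partition :: "nat multiset \<Rightarrow> nat" where
  "z_partition mu = (\<Prod>i\<in>set_mset mu. i ^ count mu i * fact (count mu i))"

type_synonym ratfun = "rat poly fract"

definition param :: ratfun where
  "param = Fract [:0, 1:] 1"

text \<open>
  Polynomials in the variables \<open>x\<^sub>0, x\<^sub>1, \<dots>\<close> are finitely supported maps from
  exponent vectors to coefficients, with the convolution product.
\<close>

type_synonym 'a mpoly = "(nat \<Rightarrow>\<^sub>0 nat) \<Rightarrow>\<^sub>0 'a"

definition power_sum :: "nat \<Rightarrow> nat \<Rightarrow> 'a::comm_ring_1 mpoly" where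
  "power_sum N p = (\<Sum>i<N. Poly_Mapping.single (Poly_Mapping.single i p) 1)"

definition monomial_sym :: "nat \<Rightarrow> nat multiset \<Rightarrow> 'a::comm_ring_1 mpoly" where
  "monomial_sym N mu =
     (\<Sum>e | Poly_Mapping.keys e \<subseteq> {..<N} \<and>
            image_mset (Poly_Mapping.lookup e) (mset_set (Poly_Mapping.keys e)) = mu.
        Poly_Mapping.single e 1)"

text \<open>
  Over a field of characteristic zero the products \<open>S\<^sup>\<mu>\<close> of power sums, \<open>\<mu>\<close> ranging over
  all partitions, are a basis of the ring of symmetric functions. A symmetric function is
  represented by its coefficients in this basis; \<open>restrict_vars N\<close> is its image in the
  polynomials in \<open>N\<close> variables. Two symmetric functions are equal iff these images agree
  for all \<open>N\<close>.
\<close>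

type_synonym 'a symfun = "nat multiset \<Rightarrow>\<^sub>0 'a"

definition restrict_vars :: "nat \<Rightarrow> 'a::comm_ring_1 symfun \<Rightarrow> 'a mpoly" where
  "restrict_vars N f =
     (\<Sum>mu\<in>Poly_Mapping.keys f.
        Poly_Mapping.single 0 (Poly_Mapping.lookup f mu) *
        prod_mset (image_mset (power_sum N) mu))"

text \<open>
  The scalar product with \<open>\<langle>S\<^sup>\<lambda>, S\<^sup>\<mu>\<rangle> = \<delta>\<^bsub>\<lambda>\<mu>\<^esub> z\<^sub>\<lambda> \<alpha>\<^bsup>l(\<lambda>)\<^esup>\<close>, where \<open>\<alpha> = 1 / k\<close>.
\<close>

definition jack_inner :: "ratfun symfun \<Rightarrow> ratfun symfun \<Rightarrow> ratfun" where
  "jack_inner f g =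
     (\<Sum>mu\<in>Poly_Mapping.keys f.
        Poly_Mapping.lookup f mu * Poly_Mapping.lookup g mu *
        of_nat (z_partition mu) * (1 / param) ^ size mu)"

text \<open>
  The defining properties of the Jack polynomials \<open>P\<^sub>\<lambda> = \<Sum>\<^sub>\<mu> \<chi>\<^sup>\<lambda>\<^sub>\<mu> S\<^sup>\<mu>\<close>: unitriangularity
  in the monomial symmetric functions for the dominance order, and orthogonality. They
  determine \<open>J la\<close> for every partition \<open>la\<close>; the coefficient \<open>\<chi>\<^sup>\<lambda>\<^sub>\<mu>\<close> is
  \<open>Poly_Mapping.lookup (J la) mu\<close>. The values of \<open>J\<close> at non-partitions are irrelevant.
\<close>

definition is_jack_family :: "(nat multiset \<Rightarrow> ratfun symfun) \<Rightarrow> bool" where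
  "is_jack_family J \<longleftrightarrow>
     (\<forall>la. is_partition la \<longrightarrow>
        (\<forall>mu\<in>Poly_Mapping.keys (J la). is_partition mu) \<and>
        (\<exists>u. \<forall>N. restrict_vars N (J la) =
           monomial_sym N la +
           (\<Sum>mu | is_partition mu \<and> dominated_by mu la \<and> mu \<noteq> la.
              Poly_Mapping.single 0 (u mu) * monomial_sym N mu))) \<and>
     (\<forall>la mu. is_partition la \<longrightarrow> is_partition mu \<longrightarrow> la \<noteq> mu \<longrightarrow>
        jack_inner (J la) (J mu) = 0)"

definition eval_ratpoly :: "rat poly \<Rightarrow> complex \<Rightarrow> complex" where
  "eval_ratpoly p k = poly (map_poly of_rat p) k"

definition regular_at :: "ratfun \<Rightarrow> complex \<Rightarrow> bool" where
  "regular_at r k \<longleftrightarrow> (\<exists>a b. r = Fract a b \<and> eval_ratpoly b k \<noteq> 0)"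

definition eval_ratfun :: "ratfun \<Rightarrow> complex \<Rightarrow> complex" where
  "eval_ratfun r k =
     (THE v. \<exists>a b. r = Fract a b \<and> eval_ratpoly b k \<noteq> 0 \<and>
                   v = eval_ratpoly a k / eval_ratpoly b k)"

text \<open>
  Only \<open>x 0, \<dots>, x (n - 1)\<close> and \<open>y 0, \<dots>, y (m - 1)\<close> occur below; they stand for
  \<open>x\<^sub>1, \<dots>, x\<^sub>n\<close> and \<open>y\<^sub>1, \<dots>, y\<^sub>m\<close>.
\<close>

definition super_power_sum ::
    "nat \<Rightarrow> nat \<Rightarrow> complex \<Rightarrow> nat \<Rightarrow> (nat \<Rightarrow> complex) \<Rightarrow> (nat \<Rightarrow> complex) \<Rightarrow> complex" where
  "super_power_sum n m k p x y = (\<Sum>i<n. x i ^ p) - 1 / k * (\<Sum>j<m. y j ^ p)"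

definition super_jack ::
    "nat \<Rightarrow> nat \<Rightarrow> complex \<Rightarrow> ratfun symfun \<Rightarrow>
     (nat \<Rightarrow> complex) \<Rightarrow> (nat \<Rightarrow> complex) \<Rightarrow> complex" where
  "super_jack n m k P x y =
     (\<Sum>mu\<in>Poly_Mapping.keys P.
        eval_ratfun (Poly_Mapping.lookup P mu) k *
        prod_mset (image_mset (\<lambda>p. super_power_sum n m k p x y) mu))"

type_synonym superfun = "(nat \<Rightarrow> complex) \<Rightarrow> (nat \<Rightarrow> complex) \<Rightarrow> complex"

definition euler_x :: "nat \<Rightarrow> superfun \<Rightarrow> superfun" where
  "euler_x i f = (\<lambda>x y. x i * deriv (\<lambda>t. f (x(i := t)) y) (x i))"

definition euler_y :: "nat \<Rightarrow> superfun \<Rightarrow> superfun" where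
  "euler_y j f = (\<lambda>x y. y j * deriv (\<lambda>t. f x (y(j := t))) (y j))"

text \<open>
  The mixed term carries \<open>x\<^sub>i \<partial>/\<partial>x\<^sub>i + k y\<^sub>j \<partial>/\<partial>y\<^sub>j\<close>. This first-order operator annihilates
  every super power sum on the hyperplane \<open>x\<^sub>i = y\<^sub>j\<close>, which cancels the pole.
  With \<open>x\<^sub>i \<partial>/\<partial>x\<^sub>i - y\<^sub>j \<partial>/\<partial>y\<^sub>j\<close> in its place this fails unless \<open>k = -1\<close>: for \<open>n = m = 1\<close> the
  function \<open>x - y / k\<close> would be sent to \<open>x + y - (x + y) (x + y / k) / (x - y)\<close>.
\<close>

definition calogero_super :: "nat \<Rightarrow> nat \<Rightarrow> complex \<Rightarrow> superfun \<Rightarrow> superfun" where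
  "calogero_super n m k f = (\<lambda>x y.
       (\<Sum>i<n. euler_x i (euler_x i f) x y)
     - k * (\<Sum>j<m. euler_y j (euler_y j f) x y)
     + k * (\<Sum>j<n. \<Sum>i<j. (x i + x j) / (x i - x j) * (euler_x i f x y - euler_x j f x y))
     - (\<Sum>j<m. \<Sum>i<j. (y i + y j) / (y i - y j) * (euler_y i f x y - euler_y j f x y))
     - (\<Sum>i<n. \<Sum>j<m. (x i + y j) / (x i - y j) * (euler_x i f x y + k * euler_y j f x y)))"

text \<open>
  The points at which the coefficients of the operator are defined. An identity of rational
  functions holds iff it holds at all these points.
\<close>

definition regular_point :: "nat \<Rightarrow> nat \<Rightarrow> (nat \<Rightarrow> complex) \<Rightarrow> (nat \<Rightarrow> complex) \<Rightarrow> bool" where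
  "regular_point n m x y \<longleftrightarrow>
     inj_on x {..<n} \<and> inj_on y {..<m} \<and> (\<forall>i<n. \<forall>j<m. x i \<noteq> y j)"

text \<open>
  The zero function is not excluded: super Jack polynomials vanish identically for some
  partitions, for instance for every nonempty one if \<open>n = m = 0\<close>.
\<close>

definition is_eigenfunction :: "nat \<Rightarrow> nat \<Rightarrow> (superfun \<Rightarrow> superfun) \<Rightarrow> superfun \<Rightarrow> bool" where
  "is_eigenfunction n m D f \<longleftrightarrow>
     (\<exists>c. \<forall>x y. regular_point n m x y \<longrightarrow> D f x y = c * f x y)"

end

theory Submission
  imports Defs
begin

text \<open>
  In the coordinates \<open>p\<^sub>r = S\<^sup>r\<close> on symmetric functions let
  \<open>L = \<Sum>\<^sub>r (1 - k) r\<^sup>2 p\<^sub>r \<partial>\<^sub>r + \<Sum>\<^bsub>a,b\<^esub> (k (a + b) p\<^sub>a p\<^sub>b \<partial>\<^bsub>a+b\<^esub> + a b p\<^bsub>a+b\<^esub> \<partial>\<^sub>a \<partial>\<^sub>b)\<close>.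
  Substituting \<open>p\<^sub>r = \<Sum>\<^sub>i x\<^sub>i\<^sup>r - (1/k) \<Sum>\<^sub>j y\<^sub>j\<^sup>r\<close> turns the super Calogero operator into
  \<open>L + (k n - m) d\<close> in degree \<open>d\<close>, so it is enough that the Jack polynomials are
  eigenvectors of \<open>L\<close>. Since \<open>\<partial>\<^sub>r\<close> is adjoint to \<open>(k/r) p\<^sub>r\<close>, \<open>L\<close> is self-adjoint for the Jack
  scalar product, which is positive definite for the order on rational functions of \<open>k\<close> in which
  \<open>k\<close> is infinitely large. In \<open>N\<close> variables \<open>L\<close> is, up to a multiple of the degree, the usual
  Laplace--Beltrami operator, and dividing by \<open>x\<^sub>i - x\<^sub>j\<close> does not increase degrees in
  \<open>x\<^sub>1, \<dots>, x\<^sub>l\<close>, so \<open>L\<close> is triangular for the dominance order. A self-adjoint triangular operator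
  is diagonal in an orthogonal triangular basis; this needs no separation of eigenvalues, so no
  formula for them either. Nor is one needed to specialise \<open>k\<close>: some coefficient of \<open>P\<^sub>\<lambda>\<close> is
  nonzero at the given value (otherwise there is nothing to show), and the eigenvalue is read off there.
\<close>

subsection \<open>Power-sum coordinates and the self-adjoint operator\<close>

text \<open>Operators act on bare coefficient functions, with finite support as a separate
  condition, so that they can be written pointwise.\<close>

definition pmul :: "nat \<Rightarrow> (nat multiset \<Rightarrow> 'a::comm_ring_1) \<Rightarrow> nat multiset \<Rightarrow> 'a" where
  "pmul r f mu = (if r \<in># mu then f (mu - {#r#}) else 0)"

text \<open>The coefficient at \<open>mu\<close> comes from the monomial with one more part
  \<open>r\<close>, in which \<open>S^r\<close> has exponent
  \<open>Suc (count mu r)\<close>.\<close>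

definition pder :: "nat \<Rightarrow> (nat multiset \<Rightarrow> 'a::comm_ring_1) \<Rightarrow> nat multiset \<Rightarrow> 'a" where
  "pder r f mu = of_nat (Suc (count mu r)) * f (add_mset r mu)"

section \<open>Finite support and the pairing of coefficient functions\<close>

definition fin_supp :: "(nat multiset \<Rightarrow> 'a::zero) \<Rightarrow> bool" where
  "fin_supp f \<longleftrightarrow> finite {mu. f mu \<noteq> 0}"

text \<open>One form with three uses: \<open>v = mon s\<close> evaluates \<open>f\<close> at power
  sums, a weighted \<open>g\<close> in place of \<open>v\<close> gives the scalar product, and the
  coefficients of one monomial in all \<open>S^mu\<close> give its coefficient in the symmetric
  function. The second argument may have infinite support.\<close>

definition pairing :: "(nat multiset \<Rightarrow> 'a::comm_ring_1) \<Rightarrow> (nat multiset \<Rightarrow> 'a) \<Rightarrow> 'a" where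
  "pairing f v = (\<Sum>mu | f mu \<noteq> 0. f mu * v mu)"

lemma fin_suppI: "finite A \<Longrightarrow> (\<And>mu. f mu \<noteq> 0 \<Longrightarrow> mu \<in> A) \<Longrightarrow> fin_supp f"
  unfolding fin_supp_def by (rule finite_subset[of _ A]) auto

lemma pairing_superset:
  assumes "finite A" "\<And>mu. f mu \<noteq> 0 \<Longrightarrow> mu \<in> A"
  shows "pairing f v = (\<Sum>mu\<in>A. f mu * v mu)"
  unfolding pairing_def by (rule sum.mono_neutral_left) (use assms in auto)

lemma supp_pmul: "{mu. pmul r f mu \<noteq> 0} = add_mset r ` {mu. f mu \<noteq> 0}"
proof -
  have "mu \<in> add_mset r ` {mu. f mu \<noteq> 0}" if "pmul r f mu \<noteq> 0" for mu
    using that by (intro image_eqI[of _ _ "mu - {#r#}"]) (auto simp: pmul_def split: if_splits)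
  then show ?thesis by (auto simp: pmul_def)
qed

lemma fin_supp_pmul: "fin_supp f \<Longrightarrow> fin_supp (pmul r f)"
  by (simp add: fin_supp_def supp_pmul)

lemma fin_supp_pder: "fin_supp f \<Longrightarrow> fin_supp (pder r f)"
  unfolding fin_supp_def
  by (rule finite_subset[OF _ finite_vimageI[of "{mu. f mu \<noteq> 0}" "add_mset r"]])
     (auto simp: pder_def inj_on_def)

lemma fin_supp_add: "fin_supp f \<Longrightarrow> fin_supp g \<Longrightarrow> fin_supp (\<lambda>mu. f mu + g mu :: 'a::comm_ring_1)"
  unfolding fin_supp_def
  by (rule finite_subset[of _ "{mu. f mu \<noteq> 0} \<union> {mu. g mu \<noteq> 0}"]) auto

lemma fin_supp_diff: "fin_supp f \<Longrightarrow> fin_supp g \<Longrightarrow> fin_supp (\<lambda>mu. f mu - g mu :: 'a::comm_ring_1)"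
  unfolding fin_supp_def
  by (rule finite_subset[of _ "{mu. f mu \<noteq> 0} \<union> {mu. g mu \<noteq> 0}"]) auto

lemma fin_supp_cmult: "fin_supp f \<Longrightarrow> fin_supp (\<lambda>mu. c * f mu :: 'a::comm_ring_1)"
  unfolding fin_supp_def by (rule finite_subset[of _ "{mu. f mu \<noteq> 0}"]) auto

lemma fin_supp_sum:
  "finite I \<Longrightarrow> (\<And>i. i \<in> I \<Longrightarrow> fin_supp (f i)) \<Longrightarrow> fin_supp (\<lambda>mu. \<Sum>i\<in>I. f i mu :: 'a::comm_ring_1)"
proof (induction I rule: finite_induct)
  case empty
  then show ?case by (simp add: fin_supp_def)
next
  case (insert i I)
  then show ?case by (simp add: fin_supp_add)
qed

lemmas fin_supp_intros =
  fin_supp_pmul fin_supp_pder fin_supp_add fin_supp_diff fin_supp_cmult fin_supp_sum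

lemma pairing_add:
  assumes "fin_supp f" "fin_supp g"
  shows "pairing (\<lambda>mu. f mu + g mu) v = pairing f v + pairing g v"
proof -
  let ?A = "{mu. f mu \<noteq> 0} \<union> {mu. g mu \<noteq> 0}"
  have fin: "finite ?A" using assms by (simp add: fin_supp_def)
  have "pairing (\<lambda>mu. f mu + g mu) v = (\<Sum>mu\<in>?A. (f mu + g mu) * v mu)"
    by (rule pairing_superset[OF fin]) auto
  moreover have "pairing f v = (\<Sum>mu\<in>?A. f mu * v mu)"
    by (rule pairing_superset[OF fin]) auto
  moreover have "pairing g v = (\<Sum>mu\<in>?A. g mu * v mu)"
    by (rule pairing_superset[OF fin]) auto
  ultimately show ?thesis by (simp add: distrib_right sum.distrib)
qed

lemma pairing_cmult:
  assumes "fin_supp f"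
  shows "pairing (\<lambda>mu. c * f mu) v = c * pairing f v"
proof -
  have "pairing (\<lambda>mu. c * f mu) v = (\<Sum>mu | f mu \<noteq> 0. (c * f mu) * v mu)"
    using assms by (intro pairing_superset) (auto simp: fin_supp_def)
  then show ?thesis by (simp add: pairing_def sum_distrib_left mult.assoc)
qed

lemma pairing_diff:
  assumes "fin_supp f" "fin_supp g"
  shows "pairing (\<lambda>mu. f mu - g mu) v = pairing f v - pairing g v"
  using pairing_add[OF assms(1) fin_supp_cmult[OF assms(2), of "-1"], of v]
    pairing_cmult[OF assms(2), of "-1" v] by simp

lemma pairing_sum:
  "finite I \<Longrightarrow> (\<And>i. i \<in> I \<Longrightarrow> fin_supp (f i)) \<Longrightarrow>
    pairing (\<lambda>mu. \<Sum>i\<in>I. f i mu) v = (\<Sum>i\<in>I. pairing (f i) v)"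
proof (induction I rule: finite_induct)
  case empty
  then show ?case by (simp add: pairing_def)
next
  case (insert i I)
  then show ?case by (simp add: pairing_add fin_supp_sum)
qed

lemma pairing_cong: "(\<And>mu. f mu \<noteq> 0 \<Longrightarrow> v mu = w mu) \<Longrightarrow> pairing f v = pairing f w"
  by (simp add: pairing_def)

lemma pairing_cmult_right: "pairing f (\<lambda>mu. c * v mu) = c * pairing f v"
  by (simp add: pairing_def sum_distrib_left mult.left_commute)

lemma pairing_weighted_commute:
  assumes "fin_supp f" "fin_supp g"
  shows "pairing f (\<lambda>mu. g mu * w mu) = pairing g (\<lambda>mu. f mu * w mu)"
proof -
  let ?A = "{mu. f mu \<noteq> 0} \<union> {mu. g mu \<noteq> 0}"
  have fin: "finite ?A" using assms by (simp add: fin_supp_def)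
  have "pairing f (\<lambda>mu. g mu * w mu) = (\<Sum>mu\<in>?A. f mu * (g mu * w mu))"
    by (rule pairing_superset[OF fin]) auto
  moreover have "pairing g (\<lambda>mu. f mu * w mu) = (\<Sum>mu\<in>?A. g mu * (f mu * w mu))"
    by (rule pairing_superset[OF fin]) auto
  ultimately show ?thesis by (simp add: algebra_simps)
qed

lemma pairing_pmul: "pairing (pmul r f) v = pairing f (\<lambda>mu. v (add_mset r mu))"
  unfolding pairing_def supp_pmul
  by (subst sum.reindex) (auto simp: pmul_def inj_on_def intro!: sum.cong)

lemma pder_commute: "pder a (pder b f) = pder b (pder a f)"
  by (rule ext) (auto simp: pder_def add_mset_commute)

lemma pmul_pder: "pmul r (pder r f) mu = of_nat (count mu r) * f mu"
proof (cases "r \<in># mu")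
  case True
  then obtain nu where "mu = add_mset r nu" by (metis mset_add)
  then show ?thesis by (simp add: pmul_def pder_def)
next
  case False
  then have "count mu r = 0" by (simp add: count_eq_zero_iff)
  with False show ?thesis by (simp add: pmul_def)
qed

text \<open>\<open>pmul r\<close> and \<open>pder r\<close> are multiplication by and differentiation with respect to \<open>S\<^sup>r\<close>.
  Truncating the sum at \<open>d\<close> loses nothing in degrees up to \<open>d\<close>. The summation indices of the
  header are \<open>a\<close> and \<open>b = r - a\<close>.\<close>

definition jack_op :: "'a::comm_ring_1 \<Rightarrow> nat \<Rightarrow> (nat multiset \<Rightarrow> 'a) \<Rightarrow> nat multiset \<Rightarrow> 'a" where
  "jack_op k d f mu = (\<Sum>r=1..d. ((1 - k) * of_nat (r ^ 2)) * pmul r (pder r f) mu +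
     (\<Sum>a=1..<r. (k * of_nat r) * pmul a (pmul (r - a) (pder r f)) mu +
                of_nat (a * (r - a)) * pmul r (pder a (pder (r - a) f)) mu))"

lemma pairing_jack_op:
  assumes "fin_supp f"
  shows "pairing (jack_op k d f) v = (\<Sum>r=1..d. ((1 - k) * of_nat (r ^ 2)) * pairing (pmul r (pder r f)) v +
     (\<Sum>a=1..<r. (k * of_nat r) * pairing (pmul a (pmul (r - a) (pder r f))) v +
                of_nat (a * (r - a)) * pairing (pmul r (pder a (pder (r - a) f))) v))"
  unfolding jack_op_def using assms
  by (simp only: pairing_sum pairing_add pairing_cmult fin_supp_intros
        finite_atLeastAtMost finite_atLeastLessThan)

text \<open>The recursion for \<open>w\<close> makes \<open>of_nat r / k\<close> times
  \<open>pder r\<close> the adjoint of \<open>pmul r\<close>. So \<open>pmul r (pder r f)\<close> is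
  self-adjoint, and the term splitting \<open>r\<close> into \<open>a\<close> and
  \<open>r - a\<close> is adjoint to the term merging them.\<close>

lemma jack_op_adjoint:
  fixes k :: "'a::field"
  assumes k: "k \<noteq> 0" and f: "fin_supp f" and g: "fin_supp g"
    and w: "\<And>r mu. w (add_mset r mu) = of_nat (r * Suc (count mu r)) / k * w mu"
  shows "pairing (jack_op k d f) (\<lambda>mu. g mu * w mu) = pairing (jack_op k d g) (\<lambda>mu. f mu * w mu)"
proof -
  define inn where "inn f g = pairing f (\<lambda>mu. g mu * w mu)" for f g
  have sym: "inn f g = inn g f" if "fin_supp f" "fin_supp g" for f g
    unfolding inn_def by (rule pairing_weighted_commute[OF that])
  have adj: "inn (pmul r f) g = of_nat r / k * inn f (pder r g)" for r f g
    unfolding inn_def pairing_pmul pairing_cmult_right[symmetric]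
    using k by (intro pairing_cong) (simp add: w pder_def field_simps)
  have diag: "inn (pmul r (pder r f)) g = inn (pmul r (pder r g)) f" for r
    unfolding adj using sym[of "pder r f" "pder r g"] f g by (simp add: fin_supp_pder)
  \<comment> \<open>Two adjoints on the left produce \<open>a * b / k^2\<close>, one on the right
    produces \<open>r / k\<close>; the prefactors \<open>k * r\<close> and \<open>a * b\<close> in
    \<open>jack_op\<close> balance them.\<close>
  have off: "(k * of_nat r) * inn (pmul a (pmul b (pder r f))) g
      = of_nat (a * b) * inn (pmul r (pder a (pder b g))) f"
    if "fin_supp f" "fin_supp g" for f g r a b
    unfolding adj using sym[of "pder r f" "pder a (pder b g)"] that k
    by (simp add: fin_supp_pder pder_commute)
  note expand = pairing_jack_op[where v = "\<lambda>mu. h mu * w mu" for h, folded inn_def]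
  \<comment> \<open>The splitting term of \<open>f\<close> becomes the merging term of
    \<open>g\<close> and conversely, so the two inner summands change places.\<close>
  show ?thesis
    unfolding inn_def[symmetric] expand[OF f] expand[OF g] diag
    by (rule sum.cong[OF refl], rule arg_cong2[where f = "(+)", OF refl], rule sum.cong[OF refl])
       (simp only: off[OF f g] off[OF g f] add.commute)
qed

subsection \<open>Evaluation at power sums\<close>

definition mon :: "(nat \<Rightarrow> 'a::comm_ring_1) \<Rightarrow> nat multiset \<Rightarrow> 'a" where
  "mon s mu = prod_mset (image_mset s mu)"

lemma mon_empty [simp]: "mon s {#} = 1" and mon_add [simp]: "mon s (add_mset r mu) = s r * mon s mu"
  by (simp_all add: mon_def)

text \<open>Leibniz rule: the value on \<open>S^mu\<close> of the derivation sending each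
  \<open>s r\<close> to \<open>\<delta> r\<close>. It serves for Euler operators on polynomials, for
  complex derivatives and for the grading.\<close>

definition mderiv :: "(nat \<Rightarrow> 'a::comm_ring_1) \<Rightarrow> (nat \<Rightarrow> 'a) \<Rightarrow> nat multiset \<Rightarrow> 'a" where
  "mderiv s \<delta> mu = (\<Sum>r\<in>#mu. \<delta> r * mon s (mu - {#r#}))"

lemma mderiv_empty [simp]: "mderiv s \<delta> {#} = 0"
  by (simp add: mderiv_def)

lemma mderiv_add [simp]:
  "mderiv s \<delta> (add_mset p mu) = \<delta> p * mon s mu + s p * mderiv s \<delta> mu"
proof -
  have "(\<Sum>r\<in>#mu. \<delta> r * mon s (add_mset p mu - {#r#})) = (\<Sum>r\<in>#mu. s p * (\<delta> r * mon s (mu - {#r#})))"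
    by (intro arg_cong[where f = sum_mset] image_mset_cong) (simp add: algebra_simps)
  then show ?thesis by (simp add: mderiv_def sum_mset_distrib_left)
qed

lemma sum_mset_count:
  assumes "finite A" "set_mset mu \<subseteq> A"
  shows "(\<Sum>r\<in>#mu. g r) = (\<Sum>r\<in>A. of_nat (count mu r) * g r :: 'a::comm_ring_1)"
  using assms(2)
proof (induction mu)
  case (add p mu)
  have "(\<Sum>r\<in>A. of_nat (count (add_mset p mu) r) * g r)
    = (\<Sum>r\<in>A. of_nat (count mu r) * g r + (if r = p then g r else 0))"
    by (intro sum.cong) (auto simp: algebra_simps)
  with add assms(1) show ?case by (simp add: sum.distrib)
qed simp

text \<open>An upper bound on the weight, unlike an exact degree, survives \<open>pder\<close> with
  the same \<open>d\<close>. It makes sums over \<open>r = 1..d\<close> exhaustive.\<close>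

definition bdd_wt :: "nat \<Rightarrow> (nat multiset \<Rightarrow> 'a::zero) \<Rightarrow> bool" where
  "bdd_wt d f \<longleftrightarrow> (\<forall>mu. f mu \<noteq> 0 \<longrightarrow> is_partition mu \<and> sum_mset mu \<le> d)"

definition homog :: "nat \<Rightarrow> (nat multiset \<Rightarrow> 'a::zero) \<Rightarrow> bool" where
  "homog d f \<longleftrightarrow> (\<forall>mu. f mu \<noteq> 0 \<longrightarrow> is_partition mu \<and> sum_mset mu = d)"

lemma homog_imp_bdd_wt: "homog d f \<Longrightarrow> bdd_wt d f"
  by (auto simp: homog_def bdd_wt_def)

lemma size_le_sum_mset: "is_partition mu \<Longrightarrow> size mu \<le> sum_mset mu"
  by (induction mu) (auto simp: is_partition_def)

lemma finite_partitions: "finite {mu. is_partition mu \<and> sum_mset mu \<le> d}"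
proof (rule finite_subset)
  show "{mu. is_partition mu \<and> sum_mset mu \<le> d} \<subseteq> mset ` {xs. set xs \<subseteq> {..d} \<and> length xs \<le> d}"
  proof
    fix mu assume mu: "mu \<in> {mu. is_partition mu \<and> sum_mset mu \<le> d}"
    obtain xs where xs: "mu = mset xs" by (metis ex_mset)
    have "r \<le> d" if "r \<in># mu" for r
      using that mu by (auto dest!: multi_member_split)
    moreover have "length xs \<le> d"
      using size_le_sum_mset[of mu] mu xs by auto
    ultimately show "mu \<in> mset ` {xs. set xs \<subseteq> {..d} \<and> length xs \<le> d}"
      using xs by auto
  qed
  show "finite (mset ` {xs. set xs \<subseteq> {..d} \<and> length xs \<le> d})"
    by (intro finite_imageI finite_lists_length_le) auto
qed

lemma bdd_wt_fin_supp: "bdd_wt d f \<Longrightarrow> fin_supp f"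
  by (rule fin_suppI[OF finite_partitions[of d]]) (auto simp: bdd_wt_def)

lemma bdd_wt_pder: "bdd_wt d f \<Longrightarrow> bdd_wt d (pder r f)"
  unfolding bdd_wt_def pder_def is_partition_def
  by (metis add_leD2 insert_iff mult_zero_right set_mset_add_mset_insert sum_mset.add_mset)

lemma pder_pder_eq_0:
  assumes "bdd_wt d f" "a + b > d"
  shows "pder a (pder b f) = (\<lambda>_. 0)"
proof
  fix mu
  have "f (add_mset b (add_mset a mu)) = 0"
    using assms unfolding bdd_wt_def by (metis add.assoc add.commute le_add1 leD order_le_less_trans sum_mset.add_mset)
  then show "pder a (pder b f) mu = 0" by (simp add: pder_def)
qed

definition ev :: "(nat \<Rightarrow> 'a::comm_ring_1) \<Rightarrow> (nat multiset \<Rightarrow> 'a) \<Rightarrow> 'a" where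
  "ev s f = pairing f (mon s)"

lemma ev_pmul: "ev s (pmul r f) = s r * ev s f"
  by (simp add: ev_def pairing_pmul pairing_cmult_right)

lemma ev_zero [simp]: "ev s (\<lambda>_. 0) = 0"
  by (simp add: ev_def pairing_def)

lemma pairing_pder:
  assumes "fin_supp f"
  shows "pairing (pder r f) u = pairing f (\<lambda>mu. of_nat (count mu r) * u (mu - {#r#}))"
proof -
  \<comment> \<open>Multiplying back by \<open>S^r\<close> makes the operator diagonal:
    \<open>pmul r (pder r f)\<close> is \<open>f\<close> scaled by \<open>count mu r\<close>, so its
    support lies in that of \<open>f\<close>.\<close>
  have "pairing (pder r f) u = pairing (pmul r (pder r f)) (\<lambda>mu. u (mu - {#r#}))"
    by (simp add: pairing_pmul)
  also have "\<dots> = (\<Sum>mu | f mu \<noteq> 0. pmul r (pder r f) mu * u (mu - {#r#}))"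
    using assms by (intro pairing_superset) (auto simp: fin_supp_def pmul_pder)
  also have "\<dots> = pairing f (\<lambda>mu. of_nat (count mu r) * u (mu - {#r#}))"
    by (simp add: pairing_def pmul_pder algebra_simps)
  finally show ?thesis .
qed

lemma pairing_sum_right: "pairing f (\<lambda>mu. \<Sum>i\<in>I. v i mu) = (\<Sum>i\<in>I. pairing f (v i))"
  unfolding pairing_def sum_distrib_left by (rule sum.swap)

text \<open>Chain rule for a polynomial in the power sums: counting the parts of \<open>mu\<close>
  by value turns the Leibniz sum into a sum over \<open>r\<close>. Parts of a partition of weight at
  most \<open>d\<close> lie in \<open>{1..d}\<close>.\<close>

lemma pairing_mderiv:
  assumes "bdd_wt d f"
  shows "pairing f (mderiv s \<delta>) = (\<Sum>r=1..d. \<delta> r * ev s (pder r f))"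
proof -
  have "mderiv s \<delta> mu = (\<Sum>r=1..d. of_nat (count mu r) * (\<delta> r * mon s (mu - {#r#})))" if "f mu \<noteq> 0" for mu
    unfolding mderiv_def
  proof (rule sum_mset_count)
    show "set_mset mu \<subseteq> {1..d}"
    proof
      fix r assume r: "r \<in># mu"
      have "is_partition mu" "sum_mset mu \<le> d" using that assms by (auto simp: bdd_wt_def)
      with r show "r \<in> {1..d}" by (auto simp: is_partition_def Suc_le_eq intro: gr0I dest!: multi_member_split)
    qed
  qed simp
  then have "pairing f (mderiv s \<delta>) = pairing f (\<lambda>mu. \<Sum>r=1..d. \<delta> r * (of_nat (count mu r) * mon s (mu - {#r#})))"
    by (intro pairing_cong) (simp add: algebra_simps)
  also have "\<dots> = (\<Sum>r=1..d. \<delta> r * ev s (pder r f))"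
    by (simp only: pairing_sum_right pairing_cmult_right ev_def pairing_pder[OF bdd_wt_fin_supp[OF assms]])
  finally show ?thesis .
qed

lemma mderiv_euler: "mderiv s (\<lambda>r. of_nat r * s r) mu = of_nat (sum_mset mu) * mon s mu"
  by (induction mu) (simp_all add: algebra_simps)

lemma ev_euler:
  assumes "homog d f"
  shows "(\<Sum>r=1..d. of_nat r * s r * ev s (pder r f)) = of_nat d * ev s f"
proof -
  have "(\<Sum>r=1..d. of_nat r * s r * ev s (pder r f)) = pairing f (mderiv s (\<lambda>r. of_nat r * s r))"
    using pairing_mderiv[OF homog_imp_bdd_wt[OF assms], of s "\<lambda>r. of_nat r * s r"] by simp
  also have "\<dots> = pairing f (\<lambda>mu. of_nat d * mon s mu)"
    using assms by (intro pairing_cong) (auto simp: mderiv_euler homog_def)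
  finally show ?thesis by (simp add: pairing_cmult_right ev_def)
qed

text \<open>The vanishing hypothesis completes the triangle \<open>a + b \<le> d\<close> to a
  square, the form in which two successive Euler operators produce their second-order terms.\<close>

lemma sum_antidiagonals:
  fixes T :: "nat \<Rightarrow> nat \<Rightarrow> 'a::comm_monoid_add"
  assumes "\<And>a b. a + b > d \<Longrightarrow> T a b = 0"
  shows "(\<Sum>r=1..d. \<Sum>a=1..<r. T a (r - a)) = (\<Sum>a=1..d. \<Sum>b=1..d. T a b)"
proof -
  have "(\<Sum>r=1..d. \<Sum>a=1..<r. T a (r - a)) = (\<Sum>(r,a)\<in>(SIGMA r:{1..d}. {1..<r}). T a (r - a))"
    by (rule sum.Sigma) auto
  also have "\<dots> = (\<Sum>(a,b)\<in>{(a,b). 1 \<le> a \<and> 1 \<le> b \<and> a + b \<le> d}. T a b)"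
    by (rule sum.reindex_bij_witness[of _ "\<lambda>(a,b). (a + b, a)" "\<lambda>(r,a). (a, r - a)"]) auto
  also have "\<dots> = (\<Sum>(a,b)\<in>{1..d} \<times> {1..d}. T a b)"
    by (rule sum.mono_neutral_left) (use assms in \<open>auto simp: not_le[symmetric]\<close>)
  finally show ?thesis by (simp add: sum.cartesian_product)
qed

lemma ev_jack_op:
  assumes "bdd_wt d f"
  shows "ev s (jack_op k d f) =
    (\<Sum>r=1..d. ((1 - k) * of_nat (r ^ 2) * s r + k * of_nat r * (\<Sum>a=1..<r. s a * s (r - a))) * ev s (pder r f))
    + (\<Sum>a=1..d. \<Sum>b=1..d. of_nat (a * b) * s (a + b) * ev s (pder a (pder b f)))"
proof -
  have "(\<Sum>a=1..d. \<Sum>b=1..d. of_nat (a * b) * s (a + b) * ev s (pder a (pder b f)))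
    = (\<Sum>r=1..d. \<Sum>a=1..<r. of_nat (a * (r - a)) * s (a + (r - a)) * ev s (pder a (pder (r - a) f)))"
    by (subst sum_antidiagonals) (simp_all add: pder_pder_eq_0[OF assms])
  also have "\<dots> = (\<Sum>r=1..d. \<Sum>a=1..<r. of_nat (a * (r - a)) * (s r * ev s (pder a (pder (r - a) f))))"
    by (intro sum.cong refl) (simp add: mult.assoc)
  finally show ?thesis
    using pairing_jack_op[OF bdd_wt_fin_supp[OF assms], of k d "mon s"]
    by (simp add: ev_def[symmetric] ev_pmul sum.distrib sum_distrib_left sum_distrib_right distrib_right
        mult.assoc del: of_nat_mult of_nat_power)
qed

text \<open>For \<open>r \<ge> 1\<close> this is the polynomial
  \<open>(u + v) * (u ^ r - v ^ r) / (u - v)\<close>, written without division so that it makes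
  sense among polynomials. Each mixed monomial is listed twice to make every summand symmetric, as
  \<open>sum_pairs\<close> requires.\<close>

definition hker :: "nat \<Rightarrow> 'a::comm_ring_1 \<Rightarrow> 'a \<Rightarrow> 'a" where
  "hker r u v = (u ^ r + v ^ r) + (\<Sum>a=1..<r. u ^ a * v ^ (r - a) + u ^ (r - a) * v ^ a)"

lemma sum_reflect: "(\<Sum>a=1..<r. T (r - a) a) = (\<Sum>a=1..<r::nat. T a (r - a))"
  by (rule sum.reindex_bij_witness[of _ "\<lambda>a. r - a" "\<lambda>a. r - a"]) auto

text \<open>With \<open>T\<close> the quotient of \<open>u ^ r - v ^ r\<close> by
  \<open>u - v\<close>, both \<open>u * T\<close> and \<open>v * T\<close> consist of the middle sum
  \<open>S\<close> and one extreme power; added up they give \<open>hker r u v\<close>.\<close>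

lemma hker_eq:
  assumes "r \<ge> 1"
  shows "(u - v) * hker r u v = (u + v) * (u ^ r - v ^ r)"
proof -
  define T where "T = (\<Sum>i<r. v ^ (r - Suc i) * u ^ i)"
  define S where "S = (\<Sum>a=1..<r. u ^ a * v ^ (r - a))"
  have T: "u ^ r - v ^ r = (u - v) * T"
    unfolding T_def by (rule power_diff_sumr2)
  obtain q where q: "r = Suc q" using assms by (cases r) auto
  have "u * T = (\<Sum>i<Suc q. v ^ (q - i) * u ^ Suc i)"
    by (simp add: T_def q sum_distrib_left algebra_simps)
  also have "\<dots> = (\<Sum>i<q. v ^ (q - i) * u ^ Suc i) + u ^ r"
    by (simp add: q)
  also have "(\<Sum>i<q. v ^ (q - i) * u ^ Suc i) = S"
    unfolding S_def q by (rule sum.reindex_bij_witness[of _ "\<lambda>a. a - 1" Suc]) (auto simp: algebra_simps)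
  finally have uT: "u * T = S + u ^ r" .
  have "v * T = (\<Sum>i<Suc q. v ^ (Suc q - i) * u ^ i)"
    by (simp add: T_def q sum_distrib_left Suc_diff_le mult.assoc[symmetric] del: sum.lessThan_Suc)
  also have "\<dots> = v ^ r + (\<Sum>i<q. v ^ (q - i) * u ^ Suc i)"
    by (subst sum.lessThan_Suc_shift) (simp add: q)
  also have "(\<Sum>i<q. v ^ (q - i) * u ^ Suc i) = S"
    unfolding S_def q by (rule sum.reindex_bij_witness[of _ "\<lambda>a. a - 1" Suc]) (auto simp: algebra_simps)
  finally have vT: "v * T = v ^ r + S" .
  have "hker r u v = u ^ r + v ^ r + (S + S)"
    using sum_reflect[of "\<lambda>a b. u ^ a * v ^ b" r] by (simp add: hker_def S_def sum.distrib)
  then have "hker r u v = (u + v) * T" by (simp add: distrib_right uT vT)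
  then show ?thesis unfolding T by (simp add: mult.left_commute)
qed

section \<open>Sums of the kernel over pairs of variables\<close>

lemma sum_pairs:
  fixes u v :: "nat \<Rightarrow> 'a::comm_ring_1"
  shows "(\<Sum>j<n. \<Sum>i<j. u i * v j + v i * u j) = (\<Sum>i<n. u i) * (\<Sum>i<n. v i) - (\<Sum>i<n. u i * v i)"
  by (induction n) (simp_all add: algebra_simps sum.distrib sum_distrib_left)

text \<open>A symmetric sum over pairs is the full double sum minus its diagonal. The pure powers
  leave \<open>n - 1\<close> copies of the power sum and each of the \<open>r - 1\<close> mixed
  terms removes one more, whence \<open>n - r\<close>.\<close>

lemma sum_hker:
  fixes x :: "nat \<Rightarrow> 'a::comm_ring_1"
  assumes "r \<ge> 1"
  shows "(\<Sum>j<n. \<Sum>i<j. hker r (x i) (x j)) =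
    (of_nat n - of_nat r) * (\<Sum>i<n. x i ^ r) + (\<Sum>a=1..<r. (\<Sum>i<n. x i ^ a) * (\<Sum>i<n. x i ^ (r - a)))"
proof -
  have "(\<Sum>j<n. \<Sum>i<j. hker r (x i) (x j)) = (\<Sum>j<n. \<Sum>i<j. x i ^ r * 1 + 1 * x j ^ r)
    + (\<Sum>j<n. \<Sum>i<j. \<Sum>a=1..<r. x i ^ a * x j ^ (r - a) + x i ^ (r - a) * x j ^ a)"
    by (simp only: hker_def sum.distrib mult_1_right mult_1_left)
  also have "(\<Sum>j<n. \<Sum>i<j. x i ^ r * 1 + 1 * x j ^ r) = of_nat n * (\<Sum>i<n. x i ^ r) - (\<Sum>i<n. x i ^ r)"
    using sum_pairs[of "\<lambda>i. x i ^ r" "\<lambda>_. 1" n] by (simp add: mult.commute)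
  also have "(\<Sum>j<n. \<Sum>i<j. \<Sum>a=1..<r. x i ^ a * x j ^ (r - a) + x i ^ (r - a) * x j ^ a)
    = (\<Sum>a=1..<r. \<Sum>j<n. \<Sum>i<j. x i ^ a * x j ^ (r - a) + x i ^ (r - a) * x j ^ a)"
    by (subst sum.swap, subst (2) sum.swap, rule refl)
  also have "\<dots> = (\<Sum>a=1..<r. (\<Sum>i<n. x i ^ a) * (\<Sum>i<n. x i ^ (r - a)) - (\<Sum>i<n. x i ^ r))"
    by (intro sum.cong refl, subst sum_pairs) (simp add: power_add[symmetric])
  also have "\<dots> = (\<Sum>a=1..<r. (\<Sum>i<n. x i ^ a) * (\<Sum>i<n. x i ^ (r - a))) - (of_nat r - 1) * (\<Sum>i<n. x i ^ r)"
    using assms by (simp add: sum_subtractf of_nat_diff)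
  finally show ?thesis by (simp add: algebra_simps)
qed

lemma sum_hker_mixed:
  fixes x :: "nat \<Rightarrow> 'a::comm_ring_1"
  shows "(\<Sum>i<n. \<Sum>j<m. hker r (x i) (y j)) =
    of_nat m * (\<Sum>i<n. x i ^ r) + of_nat n * (\<Sum>j<m. y j ^ r) +
    (\<Sum>a=1..<r. (\<Sum>i<n. x i ^ a) * (\<Sum>j<m. y j ^ (r - a)) + (\<Sum>j<m. y j ^ a) * (\<Sum>i<n. x i ^ (r - a)))"
proof -
  have "(\<Sum>i<n. \<Sum>j<m. hker r (x i) (y j)) = (\<Sum>i<n. \<Sum>j<m. x i ^ r + y j ^ r)
    + (\<Sum>i<n. \<Sum>j<m. \<Sum>a=1..<r. x i ^ a * y j ^ (r - a) + x i ^ (r - a) * y j ^ a)"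
    by (simp only: hker_def sum.distrib)
  also have "(\<Sum>i<n. \<Sum>j<m. \<Sum>a=1..<r. x i ^ a * y j ^ (r - a) + x i ^ (r - a) * y j ^ a)
    = (\<Sum>a=1..<r. \<Sum>i<n. \<Sum>j<m. x i ^ a * y j ^ (r - a) + x i ^ (r - a) * y j ^ a)"
    by (subst sum.swap, subst (2) sum.swap, rule refl)
  finally show ?thesis
    by (simp add: sum.distrib sum_product sum_distrib_left sum.swap[of _ "{..<m}" "{..<n}"] mult.commute)
qed

lemma sum_pairs_hker:
  "(\<Sum>j<n. \<Sum>i<j. \<Sum>r=1..d. c r * hker r (x i) (x j)) =
    (\<Sum>r=1..d. c r * ((of_nat n - of_nat r) * (\<Sum>i<n. x i ^ r) +
      (\<Sum>a=1..<r. (\<Sum>i<n. x i ^ a) * (\<Sum>i<n. x i ^ (r - a)))))"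
proof -
  have "(\<Sum>j<n. \<Sum>i<j. \<Sum>r=1..d. c r * hker r (x i) (x j)) =
    (\<Sum>r=1..d. \<Sum>j<n. \<Sum>i<j. c r * hker r (x i) (x j))"
    by (subst sum.swap, subst (2) sum.swap, rule refl)
  also have "\<dots> = (\<Sum>r=1..d. c r * (\<Sum>j<n. \<Sum>i<j. hker r (x i) (x j)))"
    by (simp only: sum_distrib_left)
  finally show ?thesis by (simp add: sum_hker)
qed

lemma sum_pairs_hker_mixed:
  "(\<Sum>i<n. \<Sum>j<m. \<Sum>r=1..d. c r * hker r (x i) (y j)) =
    (\<Sum>r=1..d. c r * (of_nat m * (\<Sum>i<n. x i ^ r) + of_nat n * (\<Sum>j<m. y j ^ r) +
      (\<Sum>a=1..<r. (\<Sum>i<n. x i ^ a) * (\<Sum>j<m. y j ^ (r - a)) + (\<Sum>j<m. y j ^ a) * (\<Sum>i<n. x i ^ (r - a)))))"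
proof -
  have "(\<Sum>i<n. \<Sum>j<m. \<Sum>r=1..d. c r * hker r (x i) (y j)) =
    (\<Sum>r=1..d. \<Sum>i<n. \<Sum>j<m. c r * hker r (x i) (y j))"
    by (subst sum.swap, subst (2) sum.swap, rule refl)
  also have "\<dots> = (\<Sum>r=1..d. c r * (\<Sum>i<n. \<Sum>j<m. hker r (x i) (y j)))"
    by (simp only: sum_distrib_left)
  finally show ?thesis by (simp only: sum_hker_mixed)
qed

subsection \<open>Polynomials in finitely many variables\<close>

abbreviation Const :: "'a::zero \<Rightarrow> 'a mpoly" where
  "Const c \<equiv> Poly_Mapping.single 0 c"

definition Var :: "nat \<Rightarrow> 'a::zero_neq_one mpoly" where
  "Var i = Poly_Mapping.single (Poly_Mapping.single i 1) 1"

lemma lookup_single_mult: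
  fixes p :: "'b::cancel_comm_monoid_add \<Rightarrow>\<^sub>0 'a::comm_ring_1"
  shows "Poly_Mapping.lookup (Poly_Mapping.single a c * p) (a + e) = c * Poly_Mapping.lookup p e"
  by (simp add: lookup_mult lookup_single when_mult)

lemma lookup_single_mult_eq_0:
  fixes p :: "'b::cancel_comm_monoid_add \<Rightarrow>\<^sub>0 'a::comm_ring_1"
  assumes "\<And>e'. e \<noteq> a + e'"
  shows "Poly_Mapping.lookup (Poly_Mapping.single a c * p) e = 0"
  by (simp add: lookup_mult lookup_single when_mult assms)

lemma Var_power: "(Var i :: 'a::comm_ring_1 mpoly) ^ r = Poly_Mapping.single (Poly_Mapping.single i r) 1"
  by (induction r) (simp_all add: Var_def mult_single single_add[symmetric])

lemma power_sum_eq: "power_sum N r = (\<Sum>i<N. Var i ^ r)"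
  by (simp add: power_sum_def Var_power)

lemma lookup_Const_mult: "Poly_Mapping.lookup (Const c * p) e = c * Poly_Mapping.lookup p e"
  for p :: "'a::comm_ring_1 mpoly"
  using lookup_single_mult[of 0 c p e] by simp

lemma exponent_split:
  fixes e :: "nat \<Rightarrow>\<^sub>0 nat"
  assumes "r \<le> Poly_Mapping.lookup e i"
  shows "e = Poly_Mapping.single i r + (e - Poly_Mapping.single i r)"
  using assms by (intro poly_mapping_eqI) (auto simp: lookup_add lookup_minus lookup_single when_def)

lemma lookup_Var_power_mult:
  fixes p :: "'a::comm_ring_1 mpoly"
  shows "Poly_Mapping.lookup (Var i ^ r * p) e =
    (if r \<le> Poly_Mapping.lookup e i then Poly_Mapping.lookup p (e - Poly_Mapping.single i r) else 0)"
proof (cases "r \<le> Poly_Mapping.lookup e i")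
  case True
  then show ?thesis
    using lookup_single_mult[of "Poly_Mapping.single i r" 1 p "e - Poly_Mapping.single i r"]
    by (simp add: Var_power exponent_split[OF True, symmetric])
next
  case False
  then have "e \<noteq> Poly_Mapping.single i r + e'" for e'
    by (auto simp: lookup_add)
  with False show ?thesis
    by (simp add: Var_power lookup_single_mult_eq_0)
qed

lemma lookup_Var_mult:
  fixes p :: "'a::comm_ring_1 mpoly"
  shows "Poly_Mapping.lookup (Var i * p) e =
    (if 1 \<le> Poly_Mapping.lookup e i then Poly_Mapping.lookup p (e - Poly_Mapping.single i 1) else 0)"
  using lookup_Var_power_mult[of i 1 p e] by simp

text \<open>The Euler operator of the variable \<open>j\<close>. Being diagonal on monomials it
  creates no new exponents, which gives \<open>wt_below_eul\<close>.\<close>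

definition eul :: "nat \<Rightarrow> 'a::comm_ring_1 mpoly \<Rightarrow> 'a mpoly" where
  "eul j p = Poly_Mapping.mapp (\<lambda>e c. of_nat (Poly_Mapping.lookup e j) * c) p"

lemma lookup_eul: "Poly_Mapping.lookup (eul j p) e = of_nat (Poly_Mapping.lookup e j) * Poly_Mapping.lookup p e"
  by (simp add: eul_def lookup_mapp when_def in_keys_iff)

lemma eul_zero [simp]: "eul j 0 = 0"
  by (rule poly_mapping_eqI) (simp add: lookup_eul)

lemma eul_add: "eul j (p + q) = eul j p + eul j q"
  by (rule poly_mapping_eqI) (simp add: lookup_eul lookup_add algebra_simps)

lemma eul_sum: "eul j (\<Sum>i\<in>I. p i) = (\<Sum>i\<in>I. eul j (p i))"
  by (induction I rule: infinite_finite_induct) (simp_all add: eul_add)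

lemma eul_Const_mult: "eul j (Const c * p) = Const c * eul j p"
  by (rule poly_mapping_eqI) (simp add: lookup_eul lookup_Const_mult mult.left_commute)

lemma of_nat_eq_Const: "of_nat n = (Const (of_nat n) :: 'a::comm_ring_1 mpoly)"
  by simp

lemma lookup_of_nat_mult: "Poly_Mapping.lookup (of_nat n * p) e = of_nat n * Poly_Mapping.lookup p e"
  for p :: "'a::comm_ring_1 mpoly"
  unfolding of_nat_eq_Const by (rule lookup_Const_mult)

lemma eul_of_nat_mult: "eul j (of_nat n * p) = of_nat n * eul j p"
  unfolding of_nat_eq_Const by (rule eul_Const_mult)

lemma eul_Var_power_mult:
  "eul j (Var i ^ r * p) = (if i = j then of_nat r * Var i ^ r else 0) * p + Var i ^ r * eul j p"
proof (rule poly_mapping_eqI)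
  fix e
  show "Poly_Mapping.lookup (eul j (Var i ^ r * p)) e =
    Poly_Mapping.lookup ((if i = j then of_nat r * Var i ^ r else 0) * p + Var i ^ r * eul j p) e"
  proof (cases "r \<le> Poly_Mapping.lookup e i")
    case True
    then have "Poly_Mapping.lookup e j =
      Poly_Mapping.lookup (e - Poly_Mapping.single i r) j + (if i = j then r else 0)"
      by (auto simp: lookup_minus lookup_single when_def)
    with True show ?thesis
      by (simp add: lookup_eul lookup_add mult.assoc lookup_of_nat_mult lookup_Var_power_mult
        distrib_right add.commute)
  qed (auto simp: lookup_eul lookup_add mult.assoc lookup_of_nat_mult lookup_Var_power_mult)
qed

lemma eul_power_sum_mult:
  assumes "j < N"
  shows "eul j (power_sum N r * p) = of_nat r * Var j ^ r * p + power_sum N r * eul j p"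
proof -
  have "eul j (power_sum N r * p) =
    (\<Sum>i<N. (if i = j then of_nat r * Var i ^ r else 0) * p) + power_sum N r * eul j p"
    by (simp add: power_sum_eq sum_distrib_right eul_sum eul_Var_power_mult sum.distrib)
  also have "(\<Sum>i<N. (if i = j then of_nat r * Var i ^ r else 0) * p) = of_nat r * Var j ^ r * p"
    using assms by (simp add: sum_distrib_right[symmetric])
  finally show ?thesis .
qed

lemma eul_one: "eul j 1 = 0"
  by (rule poly_mapping_eqI) (simp add: lookup_eul lookup_one when_def)

lemma eul_mon:
  "j < N \<Longrightarrow> eul j (mon (power_sum N) mu) = mderiv (power_sum N) (\<lambda>r. of_nat r * Var j ^ r) mu"
  by (induction mu) (simp_all add: eul_one eul_power_sum_mult)

text \<open>\<open>ev\<close> needs coefficients and values in a single ring, so the coefficients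
  are first embedded as constant polynomials; the lemmas \<open>Const_pder\<close>,
  \<open>Const_pmul\<close> and \<open>Const_jack_op\<close> carry the operators through the
  embedding.\<close>

definition realize :: "nat \<Rightarrow> (nat multiset \<Rightarrow> 'a::comm_ring_1) \<Rightarrow> 'a mpoly" where
  "realize N f = ev (power_sum N) (\<lambda>mu. Const (f mu))"

lemma Const_eq_0_iff: "Const c = 0 \<longleftrightarrow> c = 0"
  by (metis lookup_single_eq lookup_zero single_zero)

lemma bdd_wt_Const: "bdd_wt d (\<lambda>mu. Const (f mu)) \<longleftrightarrow> bdd_wt d f"
  by (simp add: bdd_wt_def Const_eq_0_iff)

lemma Const_mult: "Const (a * b) = Const a * Const (b :: 'a::comm_ring_1)"
  by (simp add: mult_single)

lemma Const_pder: "(\<lambda>mu. Const (pder r f mu)) = pder r (\<lambda>mu. Const (f mu))"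
  by (rule ext) (simp add: pder_def Const_mult of_nat_eq_Const[symmetric] del: of_nat_Suc)

lemma Const_pmul: "(\<lambda>mu. Const (pmul r f mu)) = pmul r (\<lambda>mu. Const (f mu))"
  by (rule ext) (simp add: pmul_def)

lemma Const_sum: "Const (\<Sum>i\<in>I. f i) = (\<Sum>i\<in>I. Const (f i) :: 'a::comm_ring_1 mpoly)"
  by (induction I rule: infinite_finite_induct) (simp_all add: single_add)

lemma Const_jack_op: "(\<lambda>mu. Const (jack_op k d f mu)) = jack_op (Const k) d (\<lambda>mu. Const (f mu))"
proof -
  have "Const (1 - k) = 1 - Const k" by (simp add: single_diff)
  then show ?thesis
    unfolding jack_op_def Const_pder[symmetric] Const_pmul[symmetric] of_nat_eq_Const
    by (simp only: Const_sum single_add Const_mult)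
qed

lemma eul_realize:
  assumes "bdd_wt d f" "j < N"
  shows "eul j (realize N f) = (\<Sum>r=1..d. of_nat r * Var j ^ r * realize N (pder r f))"
proof -
  have "eul j (realize N f) = pairing (\<lambda>mu. Const (f mu)) (\<lambda>mu. eul j (mon (power_sum N) mu))"
    by (simp add: realize_def ev_def pairing_def eul_sum eul_Const_mult)
  also have "\<dots> = pairing (\<lambda>mu. Const (f mu)) (mderiv (power_sum N) (\<lambda>r. of_nat r * Var j ^ r))"
    using assms(2) by (simp add: eul_mon)
  finally show ?thesis
    using pairing_mderiv[of d "\<lambda>mu. Const (f mu)"] assms(1)
    by (simp add: bdd_wt_Const realize_def Const_pder)
qed

text \<open>The second Euler operator meets either the power of \<open>Var j\<close>, giving
  \<open>r ^ 2\<close>, or the realized derivative, giving the double sum.\<close>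

lemma eul_eul_realize:
  assumes "bdd_wt d f" "j < N"
  shows "eul j (eul j (realize N f)) = (\<Sum>r=1..d. of_nat (r ^ 2) * Var j ^ r * realize N (pder r f))
    + (\<Sum>a=1..d. \<Sum>b=1..d. of_nat (a * b) * Var j ^ (a + b) * realize N (pder a (pder b f)))"
proof -
  have "eul j (eul j (realize N f)) =
    (\<Sum>r=1..d. of_nat r * (of_nat r * Var j ^ r * realize N (pder r f) + Var j ^ r * eul j (realize N (pder r f))))"
    by (simp add: eul_realize[OF assms] eul_sum mult.assoc eul_of_nat_mult eul_Var_power_mult)
  also have "\<dots> = (\<Sum>r=1..d. of_nat (r ^ 2) * Var j ^ r * realize N (pder r f)) +
    (\<Sum>r=1..d. of_nat r * (Var j ^ r * eul j (realize N (pder r f))))"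
    by (simp add: sum.distrib distrib_left power2_eq_square mult.assoc)
  also have "(\<Sum>r=1..d. of_nat r * (Var j ^ r * eul j (realize N (pder r f)))) =
    (\<Sum>a=1..d. \<Sum>b=1..d. of_nat (a * b) * Var j ^ (a + b) * realize N (pder a (pder b f)))"
    unfolding eul_realize[OF bdd_wt_pder[OF assms(1)] assms(2)]
    by (intro sum.cong refl) (simp add: sum_distrib_left pder_commute power_add algebra_simps)
  finally show ?thesis .
qed

text \<open>This is the Laplace-Beltrami operator of the Jack polynomials, with the quotients by
  differences of variables already carried out in \<open>hker\<close>. Of the factor
  \<open>N - r\<close> in \<open>sum_hker\<close>, the \<open>- r\<close> supplies the
  \<open>- k\<close> in \<open>1 - k\<close>, while the \<open>N\<close> is cancelled by the last
  term.\<close>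

lemma realize_jack_op:
  assumes "bdd_wt d f"
  shows "realize N (jack_op k d f) = (\<Sum>j<N. eul j (eul j (realize N f)))
    + Const k * (\<Sum>j<N. \<Sum>i<j. \<Sum>r=1..d. of_nat r * realize N (pder r f) * hker r (Var i) (Var j))
    - Const k * of_nat N * (\<Sum>j<N. eul j (realize N f))"
proof -
  let ?u = "\<lambda>r. realize N (pder r f)" and ?p = "power_sum N :: nat \<Rightarrow> 'a mpoly"
  have 1: "(\<Sum>j<N. eul j (eul j (realize N f))) = (\<Sum>r=1..d. of_nat (r ^ 2) * ?p r * ?u r)
    + (\<Sum>a=1..d. \<Sum>b=1..d. of_nat (a * b) * ?p (a + b) * realize N (pder a (pder b f)))"
    by (simp add: eul_eul_realize[OF assms] sum.distrib sum.swap[of _ "{Suc 0..d}" "{..<N}"]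
        power_sum_eq sum_distrib_left sum_distrib_right)
  have 2: "(\<Sum>j<N. eul j (realize N f)) = (\<Sum>r=1..d. of_nat r * ?p r * ?u r)"
    by (simp add: eul_realize[OF assms] sum.swap[of _ "{Suc 0..d}" "{..<N}"]
        power_sum_eq sum_distrib_left sum_distrib_right)
  have 3: "(\<Sum>j<N. \<Sum>i<j. \<Sum>r=1..d. of_nat r * ?u r * hker r (Var i) (Var j)) =
    (\<Sum>r=1..d. of_nat r * ?u r * ((of_nat N - of_nat r) * ?p r + (\<Sum>a=1..<r. ?p a * ?p (r - a))))"
    by (simp only: sum_pairs_hker power_sum_eq)
  show ?thesis
    unfolding 1 2 3 unfolding realize_def Const_jack_op Const_pder
    using assms
    by (subst ev_jack_op)
      (simp_all add: bdd_wt_Const sum_distrib_left sum_subtractf[symmetric] sum.distrib[symmetric]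
        power2_eq_square algebra_simps)
qed

text \<open>Degree at most \<open>B\<close> in the first \<open>l\<close> variables. With
  \<open>B\<close> the sum of the \<open>l\<close> largest parts of a partition, and
  \<open>l\<close> arbitrary, these bounds express dominance.\<close>

definition wt_below :: "nat \<Rightarrow> nat \<Rightarrow> 'a::zero mpoly \<Rightarrow> bool" where
  "wt_below l B p \<longleftrightarrow>
    (\<forall>e. Poly_Mapping.lookup p e \<noteq> 0 \<longrightarrow> (\<Sum>i<l. Poly_Mapping.lookup e i) \<le> B)"

lemma wt_below_add: "wt_below l B p \<Longrightarrow> wt_below l B q \<Longrightarrow> wt_below l B (p + q :: 'a::comm_ring_1 mpoly)"
  unfolding wt_below_def lookup_add by (metis add_0)

lemma wt_below_diff: "wt_below l B p \<Longrightarrow> wt_below l B q \<Longrightarrow> wt_below l B (p - q :: 'a::comm_ring_1 mpoly)"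
  unfolding wt_below_def lookup_minus by (metis diff_0_right)

lemma wt_below_sum: "(\<And>i. i \<in> I \<Longrightarrow> wt_below l B (p i)) \<Longrightarrow> wt_below l B (\<Sum>i\<in>I. p i :: 'a::comm_ring_1 mpoly)"
  by (induction I rule: infinite_finite_induct) (simp_all add: wt_below_add, simp_all add: wt_below_def)

lemma wt_below_Const_mult: "wt_below l B p \<Longrightarrow> wt_below l B (Const c * p :: 'a::comm_ring_1 mpoly)"
  unfolding wt_below_def lookup_Const_mult by (metis mult_zero_right)

lemma wt_below_eul: "wt_below l B p \<Longrightarrow> wt_below l B (eul j p)"
  unfolding wt_below_def lookup_eul by (metis mult_zero_right)

text \<open>If \<open>e\<close> is an exponent of \<open>g\<close> with the largest weight and, among those, the largest entry at
  the heavier index \<open>i\<close>, then \<open>x\<^sub>i x\<^sup>e\<close> cannot cancel in \<open>(x\<^sub>i - x\<^sub>j) g\<close>.\<close>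

lemma wt_below_divide_aux:
  fixes g h :: "'a::comm_ring_1 mpoly"
  assumes eq: "(Var i - Var j) * g = (Var i + Var j) * h" and h: "wt_below l B h"
    and "i \<noteq> j" and ij: "j < l \<Longrightarrow> i < l"
  shows "wt_below l B g"
proof (rule ccontr)
  define W where "W e = (\<Sum>i<l. Poly_Mapping.lookup e i)" for e :: "nat \<Rightarrow>\<^sub>0 nat"
  define S where "S = {e \<in> Poly_Mapping.keys g. W e > B}"
  assume "\<not> wt_below l B g"
  then have "S \<noteq> {}" "finite S"
    by (auto simp: S_def W_def wt_below_def in_keys_iff not_le)
  define M where "M = Max (W ` S)"
  define T where "T = {e \<in> S. W e = M}"
  have "M \<in> W ` S" unfolding M_def using \<open>S \<noteq> {}\<close> \<open>finite S\<close> by (intro Max_in) auto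
  then have T: "T \<noteq> {}" "finite T" using \<open>finite S\<close> by (auto simp: T_def)
  define c where "c = Max ((\<lambda>e. Poly_Mapping.lookup e i) ` T)"
  have "c \<in> (\<lambda>e. Poly_Mapping.lookup e i) ` T" unfolding c_def using T by (intro Max_in) auto
  then obtain e where e: "e \<in> T" "Poly_Mapping.lookup e i = c" by auto
  have maxW: "W e' \<le> M" if "e' \<in> S" for e'
    unfolding M_def using that \<open>finite S\<close> by simp
  have maxc: "Poly_Mapping.lookup e' i \<le> c" if "e' \<in> T" for e'
    unfolding c_def using that T by simp
  have We: "W e = M" "M > B" "Poly_Mapping.lookup g e \<noteq> 0"
    using e by (auto simp: T_def S_def in_keys_iff)
  let ?e = "e + Poly_Mapping.single i 1" and ?e' = "e + Poly_Mapping.single i 1 - Poly_Mapping.single j 1"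
  have cancel: "?e - Poly_Mapping.single i 1 = e" by simp
  have He: "Poly_Mapping.lookup h e = 0"
    using h We by (auto simp: wt_below_def W_def[symmetric])
  \<comment> \<open>Shifting a unit from \<open>j\<close> to \<open>i\<close> cannot lower the
    weight: if \<open>j\<close> counts among the first \<open>l\<close> variables, then so does
    \<open>i\<close>.\<close>
  have W': "W ?e' \<ge> M" if "1 \<le> Poly_Mapping.lookup e j"
  proof -
    have j: "Poly_Mapping.single j 1 + ?e' = ?e"
      using that \<open>i \<noteq> j\<close> by (intro exponent_split[symmetric]) (simp add: lookup_add lookup_single)
    have W_add: "W (a + b) = W a + W b" for a b
      by (simp add: W_def lookup_add sum.distrib)
    have W_single: "W (Poly_Mapping.single a 1) = (if a < l then 1 else 0)" for a
      by (simp add: W_def lookup_single when_def)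
    show ?thesis
      using arg_cong[OF j, of W] ij unfolding W_add W_single We(1) by (auto split: if_splits)
  qed
  \<comment> \<open>At \<open>?e'\<close> the weight is still above \<open>B\<close>, which excludes
    \<open>h\<close>; in \<open>g\<close> it would be another exponent of maximal weight, with a
    larger entry at \<open>i\<close>.\<close>
  have "Poly_Mapping.lookup g ?e' = 0 \<and> Poly_Mapping.lookup h ?e' = 0" if j: "1 \<le> Poly_Mapping.lookup e j"
  proof
    show "Poly_Mapping.lookup g ?e' = 0"
    proof (rule ccontr)
      assume "Poly_Mapping.lookup g ?e' \<noteq> 0"
      then have "?e' \<in> S" using W'[OF j] We by (simp add: S_def in_keys_iff)
      then have "?e' \<in> T" using W'[OF j] maxW by (fastforce simp: T_def)
      from maxc[OF this] show False
        using e(2) \<open>i \<noteq> j\<close> by (simp add: lookup_add lookup_minus lookup_single)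
    qed
    show "Poly_Mapping.lookup h ?e' = 0"
      using h W'[OF j] We by (fastforce simp: wt_below_def W_def[symmetric])
  qed
  then have 0: "(if 1 \<le> Poly_Mapping.lookup ?e j then Poly_Mapping.lookup g ?e' else 0) = 0"
    "(if 1 \<le> Poly_Mapping.lookup ?e j then Poly_Mapping.lookup h ?e' else 0) = 0"
    using \<open>i \<noteq> j\<close> by (auto simp: lookup_add lookup_single)
  have "Poly_Mapping.lookup ((Var i - Var j) * g) ?e = Poly_Mapping.lookup g e"
    unfolding left_diff_distrib lookup_minus lookup_Var_mult cancel 0 by (simp add: lookup_add)
  moreover have "Poly_Mapping.lookup ((Var i + Var j) * h) ?e = 0"
    unfolding distrib_right lookup_add[of "_ * _"] lookup_Var_mult cancel 0 He by simp
  ultimately show False using eq We by simp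
qed

text \<open>\<open>wt_below_divide_aux\<close> needs the first index to be the heavier one;
  exchanging the indices and negating \<open>h\<close> covers the other case.\<close>

lemma wt_below_divide:
  fixes g h :: "'a::comm_ring_1 mpoly"
  assumes eq: "(Var i - Var j) * g = (Var i + Var j) * h" and h: "wt_below l B h" and "i \<noteq> j"
  shows "wt_below l B g"
proof (cases "j < l \<longrightarrow> i < l")
  case True
  then show ?thesis using wt_below_divide_aux[OF eq h \<open>i \<noteq> j\<close>] by auto
next
  case False
  have "(Var j - Var i) * g = - ((Var i - Var j) * g)"
    by (simp add: algebra_simps)
  also have "\<dots> = (Var j + Var i) * (0 - h)"
    unfolding eq by (simp add: algebra_simps)
  finally have "(Var j - Var i) * g = (Var j + Var i) * (0 - h)" .
  moreover have "wt_below l B (0 - h)" by (rule wt_below_diff[OF _ h]) (simp add: wt_below_def)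
  ultimately show ?thesis using False \<open>i \<noteq> j\<close> by (intro wt_below_divide_aux[of j i g "0 - h"]) auto
qed

text \<open>Euler operators keep the exponents, and each pair term in \<open>realize_jack_op\<close>
  is a quotient to which \<open>wt_below_divide\<close> applies, so the bound survives summand by
  summand.\<close>

lemma wt_below_jack_op:
  fixes f :: "nat multiset \<Rightarrow> 'a::comm_ring_1"
  assumes f: "bdd_wt d f" and B: "wt_below l B (realize N f)"
  shows "wt_below l B (realize N (jack_op k d f))"
proof -
  have G: "wt_below l B (\<Sum>r=1..d. of_nat r * realize N (pder r f) * hker r (Var i) (Var j))"
    if "i < j" "j < N" for i j
  proof (rule wt_below_divide)
    have "(Var i - Var j) * (\<Sum>r=1..d. of_nat r * realize N (pder r f) * hker r (Var i) (Var j))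
      = (\<Sum>r=1..d. of_nat r * realize N (pder r f) * ((Var i - Var j) * hker r (Var i) (Var j)))"
      by (simp add: sum_distrib_left mult.left_commute)
    also have "\<dots> = (\<Sum>r=1..d. of_nat r * realize N (pder r f) * ((Var i + Var j) * (Var i ^ r - Var j ^ r)))"
      by (intro sum.cong refl, subst hker_eq) auto
    also have "\<dots> = (Var i + Var j) * (eul i (realize N f) - eul j (realize N f))"
      using that by (simp add: eul_realize[OF f] sum_distrib_left sum_subtractf[symmetric] algebra_simps)
    finally show "(Var i - Var j) * (\<Sum>r=1..d. of_nat r * realize N (pder r f) * hker r (Var i) (Var j))
      = (Var i + Var j) * (eul i (realize N f) - eul j (realize N f))" .
    show "wt_below l B (eul i (realize N f) - eul j (realize N f))"
      by (intro wt_below_diff wt_below_eul B)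
    show "i \<noteq> j" using that by simp
  qed
  have "wt_below l B (\<Sum>j<N. \<Sum>i<j. \<Sum>r=1..d. of_nat r * realize N (pder r f) * hker r (Var i) (Var j))"
    by (rule wt_below_sum, rule wt_below_sum, rule G) auto
  then show ?thesis
    unfolding realize_jack_op[OF f] of_nat_eq_Const[of N] Const_mult[symmetric]
    by (intro wt_below_diff[OF wt_below_add[OF wt_below_sum wt_below_Const_mult]
          wt_below_Const_mult[OF wt_below_sum]] wt_below_eul B)
qed

subsection \<open>Dominance and leading monomials\<close>

definition shape :: "(nat \<Rightarrow>\<^sub>0 nat) \<Rightarrow> nat multiset" where
  "shape e = image_mset (Poly_Mapping.lookup e) (mset_set (Poly_Mapping.keys e))"

text \<open>The weakly decreasing exponent vector of shape \<open>mu\<close>. Its sums over the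
  first \<open>l\<close> variables are the partial sums in the dominance order, and the coefficient
  there is that of the monomial symmetric function of \<open>mu\<close>.\<close>

definition expo :: "nat multiset \<Rightarrow> (nat \<Rightarrow>\<^sub>0 nat)" where
  "expo mu = Poly_Mapping.nth (parts_desc mu)"

lemma mset_parts_desc [simp]: "mset (parts_desc mu) = mu"
  by (simp add: parts_desc_def)

lemma length_parts_desc [simp]: "length (parts_desc mu) = size mu"
  by (metis mset_parts_desc size_mset)

lemma set_parts_desc [simp]: "set (parts_desc mu) = set_mset mu"
  by (metis mset_parts_desc set_mset_mset)

lemma sorted_parts_desc: "sorted_wrt (\<ge>) (parts_desc mu)"
  by (simp add: parts_desc_def sorted_wrt_rev)

lemma sum_nth_default: "(\<Sum>i<l. nth_default 0 xs i) = sum_list (take l xs)" for xs :: "nat list"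
proof (induction xs arbitrary: l)
  case (Cons x xs)
  show ?case
  proof (cases l)
    case (Suc l')
    have "(\<Sum>i<Suc l'. nth_default 0 (x # xs) i) = x + (\<Sum>i<l'. nth_default 0 xs i)"
      by (subst sum.lessThan_Suc_shift) simp
    with Cons Suc show ?thesis by simp
  qed simp
qed simp

lemma sum_expo: "(\<Sum>i<l. Poly_Mapping.lookup (expo mu) i) = sum_list (take l (parts_desc mu))"
  by (simp add: expo_def sum_nth_default)

lemma keys_expo:
  assumes "is_partition mu"
  shows "Poly_Mapping.keys (expo mu) = {..<size mu}"
proof -
  have "parts_desc mu ! i \<noteq> 0" if "i < size mu" for i
  proof -
    have "parts_desc mu ! i \<in># mu" using nth_mem[of i "parts_desc mu"] that by simp
    moreover have "0 \<notin># mu" using assms by (simp add: is_partition_def)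
    ultimately show ?thesis by metis
  qed
  then have "nth_default 0 (parts_desc mu) i \<noteq> 0 \<longleftrightarrow> i < size mu" for i
    unfolding nth_default_def length_parts_desc by metis
  then show ?thesis unfolding set_eq_iff in_keys_iff expo_def lookup_nth lessThan_iff by blast
qed

lemma shape_expo:
  assumes "is_partition mu"
  shows "shape (expo mu) = mu"
proof -
  have "shape (expo mu) = image_mset (\<lambda>i. parts_desc mu ! i) (mset_set {..<size mu})"
    unfolding shape_def keys_expo[OF assms]
    by (rule image_mset_cong) (simp add: expo_def nth_default_def)
  also have "\<dots> = mset (map (\<lambda>i. parts_desc mu ! i) [0..<length (parts_desc mu)])"
    by (simp add: atLeast0LessThan)
  finally show ?thesis by (simp only: map_nth mset_parts_desc)
qed

text \<open>Take from \<open>A\<close> the head of the list if it occurs, otherwise any element; in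
  both cases what is taken is at most \<open>x\<close> and the rest fits into the tail.\<close>

lemma sum_submset_le_take:
  fixes xs :: "nat list"
  assumes "sorted_wrt (\<ge>) xs" "A \<subseteq># mset xs" "size A \<le> l"
  shows "sum_mset A \<le> sum_list (take l xs)"
  using assms
proof (induction xs arbitrary: A l)
  case (Cons x xs)
  show ?case
  proof (cases "A = {#}")
    case False
    then obtain l' where l: "l = Suc l'" using Cons.prems(3) by (cases l) auto
    obtain a where a: "a \<in># A" "A - {#a#} \<subseteq># mset xs" "a \<le> x"
    proof (cases "x \<in># A")
      case True
      then show thesis using that[of x] Cons.prems(2) by (simp add: subset_eq_diff_conv)
    next
      case nx: False
      obtain a where a: "a \<in># A" using False by blast
      have "A \<subseteq># mset xs"
        using nx Cons.prems(2)
        by (metis diff_single_trivial mset.simps(2) subset_eq_diff_conv add_mset_add_single)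
      moreover from this a have "a \<in> set xs" by (auto dest: mset_subset_eqD)
      ultimately show thesis
        using that[of a] a Cons.prems(1) by (auto intro: subset_mset.order_trans[OF diff_subset_eq_self])
    qed
    have "size (A - {#a#}) \<le> l'" using a(1) Cons.prems(3) l by (simp add: size_Diff_singleton)
    then have "sum_mset (A - {#a#}) \<le> sum_list (take l' xs)"
      using Cons.IH[OF _ a(2)] Cons.prems(1) by simp
    moreover have "sum_mset A = a + sum_mset (A - {#a#})"
      using a(1) by (metis insert_DiffM sum_mset.add_mset)
    ultimately show ?thesis using a(3) l by simp
  qed simp
qed simp

text \<open>After zeros are dropped, the first \<open>l\<close> exponents form a sub-multiset of the
  shape. This turns dominance of shapes into degree bounds.\<close>

lemma sum_le_take_shape:
  "(\<Sum>i<l. Poly_Mapping.lookup e i) \<le> sum_list (take l (parts_desc (shape e)))"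
proof -
  let ?K = "{..<l} \<inter> Poly_Mapping.keys e"
  have "(\<Sum>i<l. Poly_Mapping.lookup e i) = (\<Sum>i\<in>?K. Poly_Mapping.lookup e i)"
    by (rule sum.mono_neutral_right) (auto simp: in_keys_iff)
  also have "\<dots> = sum_mset (image_mset (Poly_Mapping.lookup e) (mset_set ?K))"
    by (simp add: sum_unfold_sum_mset)
  also have "\<dots> \<le> sum_list (take l (parts_desc (shape e)))"
  proof (rule sum_submset_le_take[OF sorted_parts_desc])
    show "image_mset (Poly_Mapping.lookup e) (mset_set ?K) \<subseteq># mset (parts_desc (shape e))"
      unfolding mset_parts_desc shape_def
      by (intro image_mset_subseteq_mono subset_imp_msubset_mset_set) auto
    show "size (image_mset (Poly_Mapping.lookup e) (mset_set ?K)) \<le> l"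
      using card_mono[of "{..<l}" ?K] by simp
  qed
  finally show ?thesis .
qed

lemma dominated_by_refl: "dominated_by mu mu"
  by (simp add: dominated_by_def)

lemma dominated_by_trans: "dominated_by mu nu \<Longrightarrow> dominated_by nu la \<Longrightarrow> dominated_by mu la"
  unfolding dominated_by_def by (metis order_trans)

text \<open>Partial sums cannot see trailing zeros; the absence of zero entries is what fixes the
  lengths.\<close>

lemma eq_if_take_sums_eq:
  fixes xs ys :: "nat list"
  assumes "\<And>i. sum_list (take i xs) = sum_list (take i ys)" "0 \<notin> set xs" "0 \<notin> set ys"
  shows "xs = ys"
  using assms
proof (induction xs ys rule: list_induct2')
  case (2 x xs)
  then show ?case using "2"(1)[of 1] by simp
next
  case (3 y ys)
  then show ?case using "3"(1)[of 1] by simp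
next
  case (4 x xs y ys)
  have xy: "x = y" using "4.prems"(1)[of 1] by simp
  have "sum_list (take i xs) = sum_list (take i ys)" for i
    using "4.prems"(1)[of "Suc i"] xy by simp
  then show ?case using "4.IH" "4.prems" xy by simp
qed simp

lemma dominated_by_antisym:
  assumes "dominated_by mu nu" "dominated_by nu mu" "is_partition mu" "is_partition nu"
  shows "mu = nu"
proof -
  have "parts_desc mu = parts_desc nu"
    by (rule eq_if_take_sums_eq) (use assms in \<open>auto simp: dominated_by_def is_partition_def intro: antisym\<close>)
  then show ?thesis by (metis mset_parts_desc)
qed

lemma shape_add_single:
  assumes "r > 0"
  shows "shape (e + Poly_Mapping.single i r) =
    (if i \<in> Poly_Mapping.keys e
     then add_mset (Poly_Mapping.lookup e i + r) (shape e - {#Poly_Mapping.lookup e i#})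
     else add_mset r (shape e))"
proof -
  let ?e = "e + Poly_Mapping.single i r" and ?K = "Poly_Mapping.keys e - {i}"
  have K: "Poly_Mapping.keys ?e = insert i ?K"
    using assms by (auto simp: in_keys_iff lookup_add lookup_single when_def split: if_splits)
  have "image_mset (Poly_Mapping.lookup ?e) (mset_set ?K) = image_mset (Poly_Mapping.lookup e) (mset_set ?K)"
    by (rule image_mset_cong) (auto simp: lookup_add lookup_single when_def)
  then have "shape ?e = add_mset (Poly_Mapping.lookup e i + r) (image_mset (Poly_Mapping.lookup e) (mset_set ?K))"
    unfolding shape_def K by (simp add: lookup_add del: insert_Diff_single)
  moreover have "shape e = add_mset (Poly_Mapping.lookup e i) (image_mset (Poly_Mapping.lookup e) (mset_set ?K))"
    if "i \<in> Poly_Mapping.keys e"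
    using that unfolding shape_def
    by (metis finite_keys image_mset_add_mset mset_set.remove)
  moreover have "Poly_Mapping.lookup e i = 0" "?K = Poly_Mapping.keys e" if "i \<notin> Poly_Mapping.keys e"
    using that by (auto simp: in_keys_iff)
  ultimately show ?thesis by (auto simp: shape_def)
qed

lemma shape_eq_empty_iff: "shape e = {#} \<longleftrightarrow> e = 0"
  by (auto simp: shape_def mset_set_empty_iff)

section \<open>Monomial coefficients of products of power sums\<close>

lemma lookup_power_sum_mult:
  "Poly_Mapping.lookup (power_sum N r * p) e = (\<Sum>i<N. if r \<le> Poly_Mapping.lookup e i
     then Poly_Mapping.lookup p (e - Poly_Mapping.single i r) else 0)"
  by (simp add: power_sum_eq sum_distrib_right lookup_sum lookup_Var_power_mult)

lemma lookup_mon_nonneg: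
  "0 \<le> (Poly_Mapping.lookup (mon (power_sum N) mu) e :: 'a::linordered_idom)"
  by (induction mu arbitrary: e) (simp_all add: lookup_one when_def lookup_power_sum_mult sum_nonneg)

text \<open>Each monomial of \<open>S\<^sup>\<mu>\<close> arises by adding up parts of \<open>\<mu>\<close>.\<close>

lemma lookup_mon_shape:
  assumes "Poly_Mapping.lookup (mon (power_sum N) mu :: 'a::comm_ring_1 mpoly) e \<noteq> 0" "is_partition mu"
  shows "sum_mset (shape e) = sum_mset mu \<and> size (shape e) \<le> size mu \<and>
    (size (shape e) = size mu \<longrightarrow> shape e = mu)"
  using assms
proof (induction mu arbitrary: e)
  case empty
  then have "e = 0" by (simp add: lookup_one when_def split: if_splits)
  then have "shape e = {#}" by (simp add: shape_eq_empty_iff)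
  then show ?case by simp
next
  case (add r mu)
  have r: "r > 0" "is_partition mu" using add.prems(2) by (auto simp: is_partition_def)
  obtain i where i: "r \<le> Poly_Mapping.lookup e i"
      "Poly_Mapping.lookup (mon (power_sum N) mu :: 'a mpoly) (e - Poly_Mapping.single i r) \<noteq> 0"
    using add.prems(1) by (auto simp: lookup_power_sum_mult elim!: sum.not_neutral_contains_not_neutral split: if_splits)
  define e' where "e' = e - Poly_Mapping.single i r"
  have e: "e = e' + Poly_Mapping.single i r"
    unfolding e'_def using exponent_split[OF i(1)] by (simp add: add.commute)
  have IH: "sum_mset (shape e') = sum_mset mu" "size (shape e') \<le> size mu"
      "size (shape e') = size mu \<Longrightarrow> shape e' = mu"
    using add.IH[OF i(2) r(2)] by (auto simp: e'_def)
  show ?case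
  proof (cases "i \<in> Poly_Mapping.keys e'")
    case False
    then show ?thesis unfolding e using IH r by (simp add: shape_add_single)
  next
    case True
    then have "Poly_Mapping.lookup e' i \<in># shape e'" by (simp add: shape_def)
    then obtain nu where nu: "shape e' = add_mset (Poly_Mapping.lookup e' i) nu" by (metis mset_add)
    show ?thesis unfolding e using IH r True by (simp add: shape_add_single nu)
  qed
qed

text \<open>Assigning each part to a variable that carries it as exponent yields a positive
  contribution, and \<open>lookup_mon_nonneg\<close> excludes cancellation.\<close>

lemma lookup_mon_pos:
  assumes "Poly_Mapping.keys e \<subseteq> {..<N}" "shape e = mu"
  shows "0 < (Poly_Mapping.lookup (mon (power_sum N) mu) e :: 'a::linordered_idom)"
  using assms
proof (induction mu arbitrary: e)
  case empty
  then show ?case by (simp add: shape_eq_empty_iff)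
next
  case (add r mu)
  then have "r \<in># shape e" by simp
  then obtain i where i: "i \<in> Poly_Mapping.keys e" "Poly_Mapping.lookup e i = r"
    by (auto simp: shape_def)
  then have r: "r > 0" by (auto simp: in_keys_iff)
  define e' where "e' = e - Poly_Mapping.single i r"
  have e: "e = e' + Poly_Mapping.single i r"
    unfolding e'_def using exponent_split[of r e i] i by (simp add: add.commute)
  have "i \<notin> Poly_Mapping.keys e'"
    using i by (simp add: e'_def in_keys_iff lookup_minus)
  then have "shape e' = mu"
    using add.prems(2) unfolding e shape_add_single[OF r] by simp
  moreover have "Poly_Mapping.keys e' \<subseteq> Poly_Mapping.keys e"
    by (auto simp: e in_keys_iff lookup_add)
  then have "Poly_Mapping.keys e' \<subseteq> {..<N}"
    using add.prems(1) by blast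
  ultimately have pos: "0 < (Poly_Mapping.lookup (mon (power_sum N) mu) e' :: 'a)"
    by (rule add.IH[rotated])
  have "i < N" using i add.prems(1) by auto
  show ?case
    unfolding mon_add lookup_power_sum_mult
    by (rule sum_pos2[of _ i]) (use \<open>i < N\<close> i pos in \<open>auto simp: e'_def[symmetric] lookup_mon_nonneg\<close>)
qed

lemma realize_eq: "realize N f = (\<Sum>mu | f mu \<noteq> 0. Const (f mu) * mon (power_sum N) mu)"
  by (simp add: realize_def ev_def pairing_def Const_eq_0_iff)

lemma lookup_realize:
  "Poly_Mapping.lookup (realize N f) e = pairing f (\<lambda>mu. Poly_Mapping.lookup (mon (power_sum N) mu) e)"
  by (simp add: realize_eq lookup_sum lookup_Const_mult pairing_def)

text \<open>Among the multisets in the support of \<open>f\<close> with the weight of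
  \<open>mu\<close>, take \<open>nu\<close> with the most parts. By \<open>lookup_mon_shape\<close>,
  \<open>S^rho\<close> reaches the monomial of \<open>nu\<close> only if \<open>rho\<close> has more
  parts than \<open>nu\<close> or equals it, so nothing else contributes there. Hence a nonzero
  \<open>f\<close> is visible in finitely many variables.\<close>

lemma realize_nonzero_coeff:
  fixes f :: "nat multiset \<Rightarrow> 'a::linordered_idom"
  assumes f: "fin_supp f" "\<And>mu. f mu \<noteq> 0 \<Longrightarrow> is_partition mu" and mu: "f mu \<noteq> 0"
  shows "\<exists>nu. f nu \<noteq> 0 \<and> sum_mset nu = sum_mset mu \<and>
    (\<forall>N\<ge>size nu. Poly_Mapping.lookup (realize N f) (expo nu) \<noteq> 0)"
proof -
  define T where "T = {nu. f nu \<noteq> 0 \<and> sum_mset nu = sum_mset mu}"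
  have T: "finite T" "T \<noteq> {}"
    using f mu by (auto simp: T_def fin_supp_def intro: finite_subset[of _ "{mu. f mu \<noteq> 0}"])
  have "Max (size ` T) \<in> size ` T" using T by (intro Max_in) auto
  then obtain nu where nu: "nu \<in> T" "size nu = Max (size ` T)" by auto
  have max: "size rho \<le> size nu" if "rho \<in> T" for rho
    using T that by (simp add: nu(2))
  have pnu: "is_partition nu" using nu f(2) by (simp add: T_def)
  have "Poly_Mapping.lookup (realize N f) (expo nu) \<noteq> 0" if "size nu \<le> N" for N
  proof -
    have "f rho * Poly_Mapping.lookup (mon (power_sum N) rho) (expo nu) = 0" if "rho \<noteq> nu" for rho
    proof (rule ccontr)
      assume "f rho * Poly_Mapping.lookup (mon (power_sum N) rho) (expo nu) \<noteq> 0"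
      then have rho: "f rho \<noteq> 0" "Poly_Mapping.lookup (mon (power_sum N) rho :: 'a mpoly) (expo nu) \<noteq> 0"
        by auto
      note * = lookup_mon_shape[OF rho(2) f(2)[OF rho(1)], unfolded shape_expo[OF pnu]]
      then have "rho \<in> T" using nu(1) rho(1) by (simp add: T_def)
      from max[OF this] * that show False by auto
    qed
    then have "Poly_Mapping.lookup (realize N f) (expo nu) =
        (\<Sum>rho\<in>{nu}. f rho * Poly_Mapping.lookup (mon (power_sum N) rho) (expo nu))"
      unfolding lookup_realize pairing_def
      using f(1) nu(1) by (intro sum.mono_neutral_right) (auto simp: fin_supp_def T_def)
    moreover have "0 < (Poly_Mapping.lookup (mon (power_sum N) nu) (expo nu) :: 'a)"
      using that pnu by (intro lookup_mon_pos) (auto simp: keys_expo shape_expo)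
    ultimately show ?thesis using nu(1) by (simp add: T_def)
  qed
  with nu(1) show ?thesis by (auto simp: T_def)
qed

lemma restrict_vars_eq: "restrict_vars N f = realize N (Poly_Mapping.lookup f)"
  by (simp add: restrict_vars_def realize_eq mon_def keys.rep_eq)

text \<open>Ensures that the sum in \<open>monomial_sym\<close> is a genuine finite sum and not the
  default value 0.\<close>

lemma finite_shape: "finite {e. Poly_Mapping.keys e \<subseteq> {..<N} \<and> shape e = mu}"
proof (rule finite_subset)
  show "{e. Poly_Mapping.keys e \<subseteq> {..<N} \<and> shape e = mu} \<subseteq>
    Poly_Mapping.nth ` {xs. set xs \<subseteq> insert 0 (set_mset mu) \<and> length xs = N}"
  proof
    fix e assume "e \<in> {e. Poly_Mapping.keys e \<subseteq> {..<N} \<and> shape e = mu}"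
    then have e: "Poly_Mapping.keys e \<subseteq> {..<N}" "shape e = mu" by auto
    have "Poly_Mapping.lookup e i = nth_default 0 (map (Poly_Mapping.lookup e) [0..<N]) i" for i
      using e(1) by (auto simp: nth_default_def in_keys_iff)
    then have "e = Poly_Mapping.nth (map (Poly_Mapping.lookup e) [0..<N])"
      by (intro poly_mapping_eqI) simp
    moreover have "Poly_Mapping.lookup e i \<in> insert 0 (set_mset mu)" for i
      using e(2)[symmetric] by (auto simp: shape_def in_keys_iff)
    ultimately show "e \<in> Poly_Mapping.nth ` {xs. set xs \<subseteq> insert 0 (set_mset mu) \<and> length xs = N}"
      by (intro image_eqI[of _ _ "map (Poly_Mapping.lookup e) [0..<N]"]) auto
  qed
  show "finite (Poly_Mapping.nth ` {xs. set xs \<subseteq> insert 0 (set_mset mu) \<and> length xs = N})"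
    by (intro finite_imageI finite_lists_length_eq) auto
qed

lemma lookup_monomial_sym:
  "Poly_Mapping.lookup (monomial_sym N mu) e = (if Poly_Mapping.keys e \<subseteq> {..<N} \<and> shape e = mu then 1 else 0)"
  unfolding monomial_sym_def shape_def[symmetric] lookup_sum
  using finite_shape[of N mu] by (simp add: lookup_single when_def)

text \<open>Once both products run over the common index set \<open>A\<close>, only the factor at
  \<open>i = r\<close> changes. This yields the recursion demanded of the weight in
  \<open>jack_op_adjoint\<close>.\<close>

lemma z_partition_add_mset: "z_partition (add_mset r mu) = r * Suc (count mu r) * z_partition mu"
proof -
  define A where "A = insert r (set_mset mu)"
  have "z_partition nu = (\<Prod>i\<in>A. i ^ count nu i * fact (count nu i))" if "set_mset nu \<subseteq> A" for nu
    unfolding z_partition_def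
    by (rule prod.mono_neutral_left) (use that in \<open>auto simp: A_def not_in_iff\<close>)
  then have z: "z_partition (add_mset r mu) = (\<Prod>i\<in>A. i ^ count (add_mset r mu) i * fact (count (add_mset r mu) i))"
    "z_partition mu = (\<Prod>i\<in>A. i ^ count mu i * fact (count mu i))"
    by (auto simp: A_def)
  define B where "B = (\<Prod>i\<in>A - {r}. i ^ count mu i * fact (count mu i))"
  have B: "(\<Prod>i\<in>A - {r}. i ^ count (add_mset r mu) i * fact (count (add_mset r mu) i)) = B"
    unfolding B_def by (rule prod.cong) auto
  have A: "finite A" "r \<in> A" by (auto simp: A_def)
  show ?thesis
    unfolding z prod.remove[OF A] B B_def[symmetric] by (simp add: algebra_simps)
qed

lemma z_partition_pos: "is_partition mu \<Longrightarrow> z_partition mu > 0"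
  by (induction mu) (simp_all add: z_partition_add_mset is_partition_def, simp add: z_partition_def)

subsection \<open>Specialisation of the parameter and the super operator\<close>

text \<open>A relation between a rational function and its value carries regularity along with the
  value, so that closure under ring operations takes no further side conditions.\<close>

definition specializes :: "complex \<Rightarrow> ratfun \<Rightarrow> complex \<Rightarrow> bool" where
  "specializes k r v \<longleftrightarrow>
    (\<exists>a b. r = Fract a b \<and> eval_ratpoly b k \<noteq> 0 \<and> v = eval_ratpoly a k / eval_ratpoly b k)"

lemma eval_ratpoly_0 [simp]: "eval_ratpoly 0 k = 0"
  by (simp add: eval_ratpoly_def)

lemma eval_ratpoly_pCons: "eval_ratpoly (pCons a p) k = of_rat a + k * eval_ratpoly p k"
  by (simp add: eval_ratpoly_def map_poly_pCons)

lemma eval_ratpoly_1 [simp]: "eval_ratpoly 1 k = 1"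
  using eval_ratpoly_pCons[of 1 0 k] by (simp add: one_pCons)

lemma eval_ratpoly_add: "eval_ratpoly (p + q) k = eval_ratpoly p k + eval_ratpoly q k"
  by (induction p q rule: poly_induct2) (simp_all add: eval_ratpoly_pCons of_rat_add algebra_simps)

lemma eval_ratpoly_smult: "eval_ratpoly (smult c p) k = of_rat c * eval_ratpoly p k"
  by (induction p) (simp_all add: eval_ratpoly_pCons of_rat_mult algebra_simps)

lemma eval_ratpoly_mult: "eval_ratpoly (p * q) k = eval_ratpoly p k * eval_ratpoly q k"
  by (induction p)
    (simp_all add: eval_ratpoly_pCons eval_ratpoly_add eval_ratpoly_smult algebra_simps)

lemma specializes_unique:
  assumes "specializes k r v" "specializes k r w"
  shows "v = w"
proof -
  obtain a b where ab: "r = Fract a b" "eval_ratpoly b k \<noteq> 0" "v = eval_ratpoly a k / eval_ratpoly b k"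
    using assms(1) by (auto simp: specializes_def)
  obtain c d where cd: "r = Fract c d" "eval_ratpoly d k \<noteq> 0" "w = eval_ratpoly c k / eval_ratpoly d k"
    using assms(2) by (auto simp: specializes_def)
  have "b \<noteq> 0" "d \<noteq> 0" using ab cd by auto
  then have "a * d = c * b" using ab(1) cd(1) by (simp add: eq_fract)
  then have "eval_ratpoly a k * eval_ratpoly d k = eval_ratpoly c k * eval_ratpoly b k"
    by (simp add: eval_ratpoly_mult[symmetric])
  then show ?thesis using ab cd by (simp add: frac_eq_eq)
qed

lemma eval_ratfun_eq: "specializes k r v \<Longrightarrow> eval_ratfun r k = v"
  unfolding eval_ratfun_def
  by (rule the_equality) (auto simp: specializes_def[symmetric] intro: specializes_unique)

lemma specializes_eval_ratfun: "regular_at r k \<Longrightarrow> specializes k r (eval_ratfun r k)"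
proof -
  assume "regular_at r k"
  then obtain v where "specializes k r v" by (auto simp: regular_at_def specializes_def)
  with eval_ratfun_eq show ?thesis by metis
qed

lemma specializes_add:
  assumes "specializes k r v" "specializes k s w"
  shows "specializes k (r + s) (v + w)"
proof -
  obtain a b where ab: "r = Fract a b" "eval_ratpoly b k \<noteq> 0" "v = eval_ratpoly a k / eval_ratpoly b k"
    using assms(1) by (auto simp: specializes_def)
  obtain c d where cd: "s = Fract c d" "eval_ratpoly d k \<noteq> 0" "w = eval_ratpoly c k / eval_ratpoly d k"
    using assms(2) by (auto simp: specializes_def)
  have "b \<noteq> 0" "d \<noteq> 0" using ab cd by auto
  with ab cd show ?thesis
    unfolding specializes_def
    by (intro exI[of _ "a * d + c * b"] exI[of _ "b * d"])
       (auto simp: eval_ratpoly_mult eval_ratpoly_add add_frac_eq)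
qed

lemma specializes_mult:
  assumes "specializes k r v" "specializes k s w"
  shows "specializes k (r * s) (v * w)"
proof -
  obtain a b where ab: "r = Fract a b" "eval_ratpoly b k \<noteq> 0" "v = eval_ratpoly a k / eval_ratpoly b k"
    using assms(1) by (auto simp: specializes_def)
  obtain c d where cd: "s = Fract c d" "eval_ratpoly d k \<noteq> 0" "w = eval_ratpoly c k / eval_ratpoly d k"
    using assms(2) by (auto simp: specializes_def)
  from ab cd show ?thesis
    unfolding specializes_def
    by (intro exI[of _ "a * c"] exI[of _ "b * d"]) (auto simp: eval_ratpoly_mult)
qed

lemma specializes_0: "specializes k 0 0" and specializes_1: "specializes k 1 1"
  unfolding specializes_def
  by (intro exI[of _ 0] exI[of _ 1], simp add: fract_collapse,
      intro exI[of _ 1] exI[of _ 1], simp add: fract_collapse)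

lemma specializes_of_nat: "specializes k (of_nat n) (of_nat n)"
  by (induction n) (simp_all add: specializes_0 specializes_1 specializes_add)

lemma specializes_param: "specializes k param k"
  unfolding specializes_def param_def
  by (intro exI[of _ "[:0, 1:]"] exI[of _ 1]) (simp add: eval_ratpoly_pCons)

lemma specializes_minus_1: "specializes k (- 1) (- 1)"
proof -
  have "(- 1 :: ratfun) = Fract (- 1) 1" by (metis One_fract_def minus_fract)
  moreover have "eval_ratpoly (- 1) k = - 1"
    using eval_ratpoly_add[of "- 1" 1 k] by (simp add: eq_neg_iff_add_eq_0)
  ultimately show ?thesis
    unfolding specializes_def by (intro exI[of _ "- 1"] exI[of _ 1]) simp
qed

lemma specializes_diff:
  "specializes k r v \<Longrightarrow> specializes k s w \<Longrightarrow> specializes k (r - s) (v - w)"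
  using specializes_add[OF _ specializes_mult[OF specializes_minus_1], of k r v s w] by simp

lemma specializes_sum:
  "(\<And>i. i \<in> I \<Longrightarrow> specializes k (f i) (g i)) \<Longrightarrow> specializes k (\<Sum>i\<in>I. f i) (\<Sum>i\<in>I. g i)"
  by (induction I rule: infinite_finite_induct) (simp_all add: specializes_0 specializes_add)

text \<open>\<open>jack_op\<close> is built from ring operations, without division by the parameter,
  so it commutes with specialisation.\<close>

lemma specializes_jack_op:
  assumes "\<And>mu. specializes k (f mu) (g mu)"
  shows "specializes k (jack_op param d f mu) (jack_op k d g mu)"
proof -
  have pder: "specializes k (pder r f mu) (pder r g mu)"
    if "\<And>mu. specializes k (f mu) (g mu)" for r f g mu
    unfolding pder_def by (intro specializes_mult specializes_of_nat that)
  have pmul: "specializes k (pmul r f mu) (pmul r g mu)"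
    if "\<And>mu. specializes k (f mu) (g mu)" for r f g mu
    unfolding pmul_def using that specializes_0 by simp
  show ?thesis
    unfolding jack_op_def
    by (intro specializes_sum specializes_add specializes_mult specializes_diff specializes_of_nat
        specializes_1 specializes_param pder pmul assms)
qed

section \<open>Evaluation at super power sums and its Euler derivatives\<close>

definition super_eval :: "nat \<Rightarrow> nat \<Rightarrow> complex \<Rightarrow> (nat multiset \<Rightarrow> complex) \<Rightarrow> superfun" where
  "super_eval n m k g x y = ev (\<lambda>p. super_power_sum n m k p x y) g"

lemma super_jack_eq: "super_jack n m k P = super_eval n m k (\<lambda>mu. eval_ratfun (Poly_Mapping.lookup P mu) k)"
proof (intro ext)
  fix x y
  have "eval_ratfun 0 k = 0" by (rule eval_ratfun_eq[OF specializes_0])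
  then show "super_jack n m k P x y = super_eval n m k (\<lambda>mu. eval_ratfun (Poly_Mapping.lookup P mu) k) x y"
    unfolding super_eval_def ev_def super_jack_def mon_def
    by (intro pairing_superset[symmetric]) (auto simp: in_keys_iff)
qed

lemma has_field_derivative_ev:
  assumes "\<And>p. ((\<lambda>t. s t p) has_field_derivative \<delta> p) (at t0)" and "bdd_wt d g"
  shows "((\<lambda>t. ev (s t) g) has_field_derivative (\<Sum>r=1..d. \<delta> r * ev (s t0) (pder r g))) (at t0)"
proof -
  have "((\<lambda>t. mon (s t) mu) has_field_derivative mderiv (s t0) \<delta> mu) (at t0)" for mu
  proof (induction mu)
    case (add p mu)
    then show ?case
      using DERIV_mult[OF assms(1)[of p] add] by (simp add: algebra_simps)
  qed simp
  then have "((\<lambda>t. ev (s t) g) has_field_derivative pairing g (mderiv (s t0) \<delta>)) (at t0)"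
    unfolding ev_def pairing_def by (intro DERIV_sum DERIV_cmult)
  then show ?thesis by (simp add: pairing_mderiv[OF assms(2)])
qed

lemma DERIV_monomial: "((\<lambda>t. t ^ p) has_field_derivative of_nat p * z ^ (p - 1)) (at z)" for z :: complex
  by (auto intro!: derivative_eq_intros)

lemma DERIV_power_sum_upd:
  fixes x :: "nat \<Rightarrow> complex"
  assumes "i < n"
  shows "((\<lambda>t. \<Sum>l<n. (x(i := t)) l ^ p) has_field_derivative of_nat p * x i ^ (p - 1)) (at (x i))"
proof -
  have "((\<lambda>t. (x(i := t)) l ^ p) has_field_derivative (if l = i then of_nat p * x i ^ (p - 1) else 0)) (at (x i))" for l
    using DERIV_monomial[of p "x i"] by simp
  then have "((\<lambda>t. \<Sum>l<n. (x(i := t)) l ^ p) has_field_derivative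
      (\<Sum>l<n. if l = i then of_nat p * x i ^ (p - 1) else 0)) (at (x i))"
    by (intro DERIV_sum)
  with assms show ?thesis by simp
qed

lemma DERIV_super_eval_x:
  assumes "bdd_wt d g" "i < n"
  shows "((\<lambda>t. super_eval n m k g (x(i := t)) y) has_field_derivative
    (\<Sum>r=1..d. of_nat r * x i ^ (r - 1) * super_eval n m k (pder r g) x y)) (at (x i))"
proof -
  have "((\<lambda>t. super_power_sum n m k p (x(i := t)) y) has_field_derivative of_nat p * x i ^ (p - 1)) (at (x i))" for p
    unfolding super_power_sum_def
    using DERIV_diff[OF DERIV_power_sum_upd[OF assms(2)] DERIV_const]
    by (simp only: diff_0_right)
  from has_field_derivative_ev[of "\<lambda>t p. super_power_sum n m k p (x(i := t)) y", OF this assms(1)]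
  show ?thesis by (simp add: super_eval_def)
qed

lemma DERIV_super_eval_y:
  assumes "bdd_wt d g" "j < m"
  shows "((\<lambda>t. super_eval n m k g x (y(j := t))) has_field_derivative
    (\<Sum>r=1..d. - (1 / k) * (of_nat r * y j ^ (r - 1)) * super_eval n m k (pder r g) x y)) (at (y j))"
proof -
  have "((\<lambda>t. super_power_sum n m k p x (y(j := t))) has_field_derivative - (1 / k) * (of_nat p * y j ^ (p - 1))) (at (y j))" for p
    unfolding super_power_sum_def
    using DERIV_diff[OF DERIV_const DERIV_cmult[OF DERIV_power_sum_upd[OF assms(2)]]]
    by (simp only: diff_0 mult_minus_left)
  from has_field_derivative_ev[of "\<lambda>t p. super_power_sum n m k p x (y(j := t))", OF this assms(1)]
  show ?thesis by (simp add: super_eval_def)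
qed

text \<open>The factor in the Euler operator restores the exponent lowered by differentiation. At
  \<open>r = 0\<close> truncated subtraction would leave an extra factor \<open>a\<close>.\<close>

lemma mult_power_minus_1: "r \<ge> 1 \<Longrightarrow> a * (c * a ^ (r - 1)) = c * a ^ r" for a :: "'a::comm_ring_1"
  by (cases r) (simp_all add: mult.left_commute)

text \<open>An equality of functions and not only of values, so that the Euler operator can be
  applied once more.\<close>

lemma euler_x_super_eval:
  assumes "bdd_wt d g" "i < n"
  shows "euler_x i (super_eval n m k g) =
    (\<lambda>x y. \<Sum>r=1..d. of_nat r * x i ^ r * super_eval n m k (pder r g) x y)"
  unfolding euler_x_def DERIV_imp_deriv[OF DERIV_super_eval_x[OF assms]] sum_distrib_left
  by (intro ext sum.cong refl) (simp only: mult.assoc[symmetric] atLeastAtMost_iff,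
    metis mult.assoc mult_power_minus_1)

lemma euler_y_super_eval:
  assumes "bdd_wt d g" "j < m"
  shows "euler_y j (super_eval n m k g) =
    (\<lambda>x y. \<Sum>r=1..d. - (1 / k) * (of_nat r * y j ^ r) * super_eval n m k (pder r g) x y)"
  unfolding euler_y_def DERIV_imp_deriv[OF DERIV_super_eval_y[OF assms]] sum_distrib_left
  by (intro ext sum.cong refl) (auto simp: mult_power_minus_1[symmetric])

lemma euler_x_euler_x_super_eval:
  assumes "bdd_wt d g" "i < n"
  shows "euler_x i (euler_x i (super_eval n m k g)) x y =
    (\<Sum>r=1..d. of_nat (r ^ 2) * x i ^ r * super_eval n m k (pder r g) x y)
    + (\<Sum>a=1..d. \<Sum>b=1..d. of_nat (a * b) * x i ^ (a + b) * super_eval n m k (pder a (pder b g)) x y)"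
proof -
  let ?u = "\<lambda>r. super_eval n m k (pder r g)"
  have D: "((\<lambda>t. \<Sum>r=1..d. of_nat r * t ^ r * ?u r (x(i := t)) y) has_field_derivative
    (\<Sum>r=1..d. of_nat r * (of_nat r * x i ^ (r - 1)) * ?u r x y + (\<Sum>b=1..d. of_nat b * x i ^ (b - 1) *
        super_eval n m k (pder b (pder r g)) x y) * (of_nat r * x i ^ r))) (at (x i))"
  proof (rule DERIV_sum)
    fix r
    show "((\<lambda>t. of_nat r * t ^ r * ?u r (x(i := t)) y) has_field_derivative
      of_nat r * (of_nat r * x i ^ (r - 1)) * ?u r x y + (\<Sum>b=1..d. of_nat b * x i ^ (b - 1) *
        super_eval n m k (pder b (pder r g)) x y) * (of_nat r * x i ^ r)) (at (x i))"
      using DERIV_mult[OF DERIV_cmult[OF DERIV_monomial]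
          DERIV_super_eval_x[OF bdd_wt_pder[OF assms(1)] assms(2)]]
      unfolding fun_upd_triv .
  qed
  have "euler_x i (euler_x i (super_eval n m k g)) x y = x i * deriv (\<lambda>t. \<Sum>r=1..d. of_nat r * t ^ r * ?u r (x(i := t)) y) (x i)"
    unfolding euler_x_super_eval[OF assms] by (simp add: euler_x_def)
  also have "\<dots> = (\<Sum>r=1..d. of_nat r * (x i * (of_nat r * x i ^ (r - 1))) * ?u r x y) +
     (\<Sum>r=1..d. \<Sum>b=1..d. x i * (of_nat b * x i ^ (b - 1)) * super_eval n m k (pder b (pder r g)) x y * (of_nat r * x i ^ r))"
    unfolding DERIV_imp_deriv[OF D]
    by (simp add: sum_distrib_left sum_distrib_right sum.distrib distrib_left mult_ac)
  also have "\<dots> = (\<Sum>r=1..d. of_nat (r ^ 2) * x i ^ r * ?u r x y)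
    + (\<Sum>a=1..d. \<Sum>b=1..d. of_nat (a * b) * x i ^ (a + b) * super_eval n m k (pder a (pder b g)) x y)"
    by (intro arg_cong2[where f = "(+)"] sum.cong refl; subst mult_power_minus_1)
      (simp_all add: power2_eq_square power_add pder_commute mult_ac)
  finally show ?thesis .
qed

lemma euler_y_euler_y_super_eval:
  assumes "bdd_wt d g" "j < m"
  shows "euler_y j (euler_y j (super_eval n m k g)) x y =
    - (1 / k) * (\<Sum>r=1..d. of_nat (r ^ 2) * y j ^ r * super_eval n m k (pder r g) x y)
    + (1 / k) ^ 2 * (\<Sum>a=1..d. \<Sum>b=1..d. of_nat (a * b) * y j ^ (a + b) * super_eval n m k (pder a (pder b g)) x y)"
proof -
  let ?u = "\<lambda>r. super_eval n m k (pder r g)"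
  have D: "((\<lambda>t. \<Sum>r=1..d. - (1 / k) * (of_nat r * t ^ r) * ?u r x (y(j := t))) has_field_derivative
    (\<Sum>r=1..d. - (1 / k) * (of_nat r * (of_nat r * y j ^ (r - 1))) * ?u r x y +
      (\<Sum>b=1..d. - (1 / k) * (of_nat b * y j ^ (b - 1)) *
        super_eval n m k (pder b (pder r g)) x y) * (- (1 / k) * (of_nat r * y j ^ r)))) (at (y j))"
  proof (rule DERIV_sum)
    fix r
    show "((\<lambda>t. - (1 / k) * (of_nat r * t ^ r) * ?u r x (y(j := t))) has_field_derivative
      - (1 / k) * (of_nat r * (of_nat r * y j ^ (r - 1))) * ?u r x y +
      (\<Sum>b=1..d. - (1 / k) * (of_nat b * y j ^ (b - 1)) *
        super_eval n m k (pder b (pder r g)) x y) * (- (1 / k) * (of_nat r * y j ^ r))) (at (y j))"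
      using DERIV_mult[OF DERIV_cmult[OF DERIV_cmult[OF DERIV_monomial]]
          DERIV_super_eval_y[OF bdd_wt_pder[OF assms(1)] assms(2)]]
      unfolding fun_upd_triv .
  qed
  have "euler_y j (euler_y j (super_eval n m k g)) x y =
      y j * deriv (\<lambda>t. \<Sum>r=1..d. - (1 / k) * (of_nat r * t ^ r) * ?u r x (y(j := t))) (y j)"
    unfolding euler_y_super_eval[OF assms] by (simp add: euler_y_def)
  also have "\<dots> = - (1 / k) * (\<Sum>r=1..d. of_nat r * (y j * (of_nat r * y j ^ (r - 1))) * ?u r x y) +
     (1 / k) ^ 2 * (\<Sum>r=1..d. \<Sum>b=1..d. y j * (of_nat b * y j ^ (b - 1)) * super_eval n m k (pder b (pder r g)) x y * (of_nat r * y j ^ r))"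
    unfolding DERIV_imp_deriv[OF D] distrib_left sum.distrib sum_distrib_left sum_distrib_right
    by (intro arg_cong2[where f = "(+)"] sum.cong refl) (simp_all add: power2_eq_square)
  also have "\<dots> = - (1 / k) * (\<Sum>r=1..d. of_nat (r ^ 2) * y j ^ r * ?u r x y)
    + (1 / k) ^ 2 * (\<Sum>a=1..d. \<Sum>b=1..d. of_nat (a * b) * y j ^ (a + b) * super_eval n m k (pder a (pder b g)) x y)"
    by (intro arg_cong2[where f = "(+)"] arg_cong[where f = "(*) _"] sum.cong refl;
        subst mult_power_minus_1)
      (simp_all add: power2_eq_square power_add pder_commute mult_ac)
  finally show ?thesis .
qed

lemma hker_divide:
  fixes u v :: "'a::field"
  assumes "r \<ge> 1" "u \<noteq> v"
  shows "(u + v) / (u - v) * (u ^ r - v ^ r) = hker r u v"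
  using hker_eq[OF assms(1), of u v] assms(2) by (simp add: field_simps)

text \<open>First-order terms are matched separately for each \<open>r\<close> in
  \<open>lin\<close>. Second-order terms combine because \<open>k * (1 / k) ^ 2\<close> is the
  coefficient \<open>1 / k\<close> of the super power sum. At a regular point the quotients are the
  polynomials \<open>hker\<close>.\<close>

lemma calogero_super_eval:
  assumes g: "homog d g" and k: "k \<noteq> 0" and reg: "regular_point n m x y"
  shows "calogero_super n m k (super_eval n m k g) x y =
    super_eval n m k (jack_op k d g) x y + (k * of_nat n - of_nat m) * of_nat d * super_eval n m k g x y"
proof -
  note g' = homog_imp_bdd_wt[OF g]
  define u where "u r = super_eval n m k (pder r g) x y" for r
  define q where "q a b = super_eval n m k (pder a (pder b g)) x y" for a b
  define P where "P p = (\<Sum>i<n. x i ^ p)" for p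
  define R where "R p = (\<Sum>j<m. y j ^ p)" for p
  have S: "super_power_sum n m k p x y = P p - 1 / k * R p" for p
    by (simp add: super_power_sum_def P_def R_def)
  have ex: "euler_x i (super_eval n m k g) x y = (\<Sum>r=1..d. of_nat r * x i ^ r * u r)" if "i < n" for i
    by (simp add: euler_x_super_eval[OF g' that] u_def)
  have ey: "euler_y j (super_eval n m k g) x y = - (1 / k) * (\<Sum>r=1..d. of_nat r * y j ^ r * u r)" if "j < m" for j
    unfolding euler_y_super_eval[OF g' that] u_def sum_distrib_left by (simp add: mult.assoc)
  have 1: "(\<Sum>i<n. euler_x i (euler_x i (super_eval n m k g)) x y) =
    (\<Sum>r=1..d. of_nat (r ^ 2) * P r * u r) + (\<Sum>a=1..d. \<Sum>b=1..d. of_nat (a * b) * P (a + b) * q a b)"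
    by (simp add: euler_x_euler_x_super_eval[OF g'] u_def q_def P_def sum.distrib
        sum.swap[of _ "{Suc 0..d}" "{..<n}"] sum_distrib_left sum_distrib_right)
  have 2: "(\<Sum>j<m. euler_y j (euler_y j (super_eval n m k g)) x y) =
    - (1 / k) * (\<Sum>r=1..d. of_nat (r ^ 2) * R r * u r)
    + (1 / k) ^ 2 * (\<Sum>a=1..d. \<Sum>b=1..d. of_nat (a * b) * R (a + b) * q a b)"
  proof -
    have "(\<Sum>j<m. euler_y j (euler_y j (super_eval n m k g)) x y) =
      - (1 / k) * (\<Sum>j<m. \<Sum>r=1..d. of_nat (r ^ 2) * y j ^ r * u r)
      + (1 / k) ^ 2 * (\<Sum>j<m. \<Sum>a=1..d. \<Sum>b=1..d. of_nat (a * b) * y j ^ (a + b) * q a b)"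
      unfolding sum_distrib_left[of _ _ "{..<m}"] sum.distrib[of _ _ "{..<m}", symmetric] u_def q_def
      by (intro sum.cong refl euler_y_euler_y_super_eval[OF g']) simp
    then show ?thesis
      by (simp add: R_def sum.swap[of _ "{Suc 0..d}" "{..<m}"] sum_distrib_left sum_distrib_right)
  qed
  have 3: "(\<Sum>j<n. \<Sum>i<j. (x i + x j) / (x i - x j) *
      (euler_x i (super_eval n m k g) x y - euler_x j (super_eval n m k g) x y)) =
    (\<Sum>r=1..d. of_nat r * u r * ((of_nat n - of_nat r) * P r + (\<Sum>a=1..<r. P a * P (r - a))))"
    unfolding P_def sum_pairs_hker[symmetric]
  proof (intro sum.cong refl)
    fix i j assume "j \<in> {..<n}" "i \<in> {..<j}"
    then have ij: "i < n" "j < n" "x i \<noteq> x j"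
      using reg by (auto simp: regular_point_def inj_on_def)
    show "(x i + x j) / (x i - x j) * (euler_x i (super_eval n m k g) x y - euler_x j (super_eval n m k g) x y)
      = (\<Sum>r=1..d. of_nat r * u r * hker r (x i) (x j))"
      unfolding ex[OF ij(1)] ex[OF ij(2)] sum_subtractf[symmetric] sum_distrib_left
      by (intro sum.cong refl, subst hker_divide[symmetric])
        (use ij in \<open>simp_all add: right_diff_distrib diff_divide_distrib mult_ac\<close>)
  qed
  have 4: "(\<Sum>j<m. \<Sum>i<j. (y i + y j) / (y i - y j) *
      (euler_y i (super_eval n m k g) x y - euler_y j (super_eval n m k g) x y)) =
    - (1 / k) * (\<Sum>r=1..d. of_nat r * u r * ((of_nat m - of_nat r) * R r + (\<Sum>a=1..<r. R a * R (r - a))))"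
    unfolding R_def sum_pairs_hker[symmetric] sum_distrib_left[of "- (1 / k)"]
  proof (intro sum.cong refl)
    fix i j assume "j \<in> {..<m}" "i \<in> {..<j}"
    then have ij: "i < m" "j < m" "y i \<noteq> y j"
      using reg by (auto simp: regular_point_def inj_on_def)
    show "(y i + y j) / (y i - y j) * (euler_y i (super_eval n m k g) x y - euler_y j (super_eval n m k g) x y)
      = (\<Sum>r=1..d. - (1 / k) * (of_nat r * u r * hker r (y i) (y j)))"
      unfolding ey[OF ij(1)] ey[OF ij(2)] right_diff_distrib[symmetric] sum_subtractf[symmetric] sum_distrib_left
      by (intro sum.cong refl, subst hker_divide[symmetric])
        (use ij in \<open>simp_all add: right_diff_distrib diff_divide_distrib mult_ac\<close>)
  qed
  have 5: "(\<Sum>i<n. \<Sum>j<m. (x i + y j) / (x i - y j) *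
      (euler_x i (super_eval n m k g) x y + k * euler_y j (super_eval n m k g) x y)) =
    (\<Sum>r=1..d. of_nat r * u r * (of_nat m * P r + of_nat n * R r +
      (\<Sum>a=1..<r. P a * R (r - a) + R a * P (r - a))))"
    unfolding P_def R_def sum_pairs_hker_mixed[symmetric]
  proof (intro sum.cong refl)
    fix i j assume "i \<in> {..<n}" "j \<in> {..<m}"
    then have ij: "i < n" "j < m" "x i \<noteq> y j"
      using reg by (auto simp: regular_point_def)
    \<comment> \<open>The factor \<open>k\<close> cancels the \<open>- (1 / k)\<close> of the
      \<open>y\<close> variables and leaves a difference of powers, divisible by
      \<open>x i - y j\<close>.\<close>
    have e: "euler_x i (super_eval n m k g) x y + k * euler_y j (super_eval n m k g) x y
      = (\<Sum>r=1..d. of_nat r * x i ^ r * u r) - (\<Sum>r=1..d. of_nat r * y j ^ r * u r)"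
      unfolding ex[OF ij(1)] ey[OF ij(2)] using k by simp
    show "(x i + y j) / (x i - y j) * (euler_x i (super_eval n m k g) x y + k * euler_y j (super_eval n m k g) x y)
      = (\<Sum>r=1..d. of_nat r * u r * hker r (x i) (y j))"
      unfolding e sum_subtractf[symmetric] sum_distrib_left
      by (intro sum.cong refl, subst hker_divide[symmetric])
        (use ij in \<open>simp_all add: right_diff_distrib diff_divide_distrib mult_ac\<close>)
  qed
  have 6: "super_eval n m k (jack_op k d g) x y =
    (\<Sum>r=1..d. ((1 - k) * of_nat (r ^ 2) * (P r - 1 / k * R r) +
      k * of_nat r * (\<Sum>a=1..<r. (P a - 1 / k * R a) * (P (r - a) - 1 / k * R (r - a)))) * u r)
    + (\<Sum>a=1..d. \<Sum>b=1..d. of_nat (a * b) * (P (a + b) - 1 / k * R (a + b)) * q a b)"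
    unfolding super_eval_def ev_jack_op[OF g'] S u_def q_def ..
  have 7: "of_nat d * super_eval n m k g x y = (\<Sum>r=1..d. of_nat r * (P r - 1 / k * R r) * u r)"
    unfolding super_eval_def ev_euler[OF g, symmetric] S u_def ..
  have quad: "(\<Sum>a=1..d. \<Sum>b=1..d. of_nat (a * b) * (P (a + b) - 1 / k * R (a + b)) * q a b) =
    (\<Sum>a=1..d. \<Sum>b=1..d. of_nat (a * b) * P (a + b) * q a b)
    - 1 / k * (\<Sum>a=1..d. \<Sum>b=1..d. of_nat (a * b) * R (a + b) * q a b)"
    unfolding sum_distrib_left sum_subtractf[symmetric]
    by (intro sum.cong refl) (simp add: algebra_simps)
  \<comment> \<open>The products of two \<open>P\<close>, of \<open>P\<close> with \<open>R\<close>,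
    and of two \<open>R\<close> come from pairs of \<open>x\<close>, mixed pairs and pairs of
    \<open>y\<close>, and assemble to products of super power sums. The terms in \<open>n\<close>
    and \<open>m\<close> collect to the shift \<open>k * n - m\<close>.\<close>
  have lin: "of_nat (r ^ 2) * P r * u r + of_nat (r ^ 2) * R r * u r
      + k * (of_nat r * u r * ((of_nat n - of_nat r) * P r + (\<Sum>a=1..<r. P a * P (r - a))))
      + 1 / k * (of_nat r * u r * ((of_nat m - of_nat r) * R r + (\<Sum>a=1..<r. R a * R (r - a))))
      - of_nat r * u r * (of_nat m * P r + of_nat n * R r + (\<Sum>a=1..<r. P a * R (r - a) + R a * P (r - a)))
    = ((1 - k) * of_nat (r ^ 2) * (P r - 1 / k * R r) +
      k * of_nat r * (\<Sum>a=1..<r. (P a - 1 / k * R a) * (P (r - a) - 1 / k * R (r - a)))) * u r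
      + (k * of_nat n - of_nat m) * (of_nat r * (P r - 1 / k * R r) * u r)" for r
  proof -
    define A where "A = (\<Sum>a=1..<r. P a * P (r - a))"
    define B where "B = (\<Sum>a=1..<r. R a * R (r - a))"
    define C where "C = (\<Sum>a=1..<r. P a * R (r - a) + R a * P (r - a))"
    have e: "(\<Sum>a=1..<r. (P a - 1 / k * R a) * (P (r - a) - 1 / k * R (r - a))) = A - 1 / k * C + (1 / k)\<^sup>2 * B"
      unfolding A_def B_def C_def sum_distrib_left sum_subtractf[symmetric] sum.distrib[symmetric]
      by (intro sum.cong refl) (simp add: algebra_simps power2_eq_square)
    show ?thesis
      unfolding e A_def[symmetric] B_def[symmetric] C_def[symmetric] using k
      by (simp add: field_simps power2_eq_square)
  qed
  \<comment> \<open>Naming the sums makes the final comparison linear in opaque quantities.\<close>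
  define X1 where "X1 = (\<Sum>r=1..d. of_nat (r ^ 2) * P r * u r)"
  define X2 where "X2 = (\<Sum>r=1..d. of_nat (r ^ 2) * R r * u r)"
  define X3 where "X3 = (\<Sum>r=1..d. of_nat r * u r * ((of_nat n - of_nat r) * P r + (\<Sum>a=1..<r. P a * P (r - a))))"
  define X4 where "X4 = (\<Sum>r=1..d. of_nat r * u r * ((of_nat m - of_nat r) * R r + (\<Sum>a=1..<r. R a * R (r - a))))"
  define X5 where "X5 = (\<Sum>r=1..d. of_nat r * u r * (of_nat m * P r + of_nat n * R r +
      (\<Sum>a=1..<r. P a * R (r - a) + R a * P (r - a))))"
  define Y where "Y = (\<Sum>r=1..d. ((1 - k) * of_nat (r ^ 2) * (P r - 1 / k * R r) +
      k * of_nat r * (\<Sum>a=1..<r. (P a - 1 / k * R a) * (P (r - a) - 1 / k * R (r - a)))) * u r)"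
  define Z where "Z = (\<Sum>r=1..d. of_nat r * (P r - 1 / k * R r) * u r)"
  define Q1 where "Q1 = (\<Sum>a=1..d. \<Sum>b=1..d. of_nat (a * b) * P (a + b) * q a b)"
  define Q2 where "Q2 = (\<Sum>a=1..d. \<Sum>b=1..d. of_nat (a * b) * R (a + b) * q a b)"
  have "X1 + X2 + k * X3 + 1 / k * X4 - X5 = Y + (k * of_nat n - of_nat m) * Z"
    unfolding X1_def X2_def X3_def X4_def X5_def Y_def Z_def sum_distrib_left[of k]
      sum_distrib_left[of "1 / k"] sum_distrib_left[of "k * of_nat n - of_nat m"]
      sum.distrib[symmetric] sum_subtractf[symmetric]
    by (rule sum.cong[OF refl lin])
  then have lin': "X1 + X2 + k * X3 + 1 / k * X4 - X5 + (Q1 - 1 / k * Q2)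
      = Y + (Q1 - 1 / k * Q2) + (k * of_nat n - of_nat m) * Z"
    by simp
  have "k * (- (1 / k) * X2 + (1 / k) ^ 2 * Q2) = - X2 + 1 / k * Q2"
    using k by (simp add: field_simps power2_eq_square)
  then have "X1 + Q1 - k * (- (1 / k) * X2 + (1 / k) ^ 2 * Q2) + k * X3 - - (1 / k) * X4 - X5
      = Y + (Q1 - 1 / k * Q2) + (k * of_nat n - of_nat m) * Z"
    unfolding lin'[symmetric] by simp
  then show ?thesis
    unfolding calogero_super_def 1 2 3 4 5 6 quad mult.assoc[of "k * of_nat n - of_nat m"] 7
      X1_def X2_def X3_def X4_def X5_def Y_def Z_def Q1_def Q2_def .
qed

subsection \<open>Jack polynomials as eigenvectors\<close>

text \<open>Each term trades parts for parts of the same total. As \<open>a\<close> and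
  \<open>r - a\<close> are positive, a zero part of \<open>mu\<close> must sit among the untouched
  parts.\<close>

lemma homog_jack_op:
  assumes f: "homog d f"
  shows "homog d (jack_op k d f)"
  unfolding homog_def
proof (intro allI impI, rule ccontr)
  fix mu assume nz: "jack_op k d f mu \<noteq> 0" and mu: "\<not> (is_partition mu \<and> sum_mset mu = d)"
  have f0: "f nu = 0" if "\<not> (is_partition nu \<and> sum_mset nu = d)" for nu
    using f that by (auto simp: homog_def)
  have diag: "pmul r (pder r f) mu = 0" for r
    by (simp add: pmul_pder f0[OF mu])
  have cut: "pmul a (pmul b (pder (a + b) f)) mu = 0" if "a > 0" "b > 0" for a b
  proof (cases "a \<in># mu \<and> b \<in># mu - {#a#}")
    case True
    then obtain mu' where mu': "mu = add_mset a mu'" by (meson mset_add)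
    with True have "b \<in># mu'" by simp
    then obtain nu where "mu' = add_mset b nu" by (meson mset_add)
    with mu' have nu: "mu = add_mset a (add_mset b nu)" by simp
    then have "f (add_mset (a + b) nu) = 0"
      using mu that by (intro f0) (auto simp: is_partition_def)
    then show ?thesis by (simp add: nu pmul_def pder_def)
  qed (auto simp: pmul_def)
  have join: "pmul (a + b) (pder a (pder b f)) mu = 0" if "a > 0" "b > 0" for a b
  proof (cases "a + b \<in># mu")
    case True
    then obtain nu where nu: "mu = add_mset (a + b) nu" by (meson mset_add)
    then have "f (add_mset b (add_mset a nu)) = 0"
      using mu that by (intro f0) (auto simp: is_partition_def)
    then show ?thesis by (simp add: nu pmul_def pder_def)
  qed (simp add: pmul_def)
  have "pmul a (pmul (r - a) (pder r f)) mu = 0 \<and> pmul r (pder a (pder (r - a) f)) mu = 0"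
    if "a \<in> {1..<r}" for a r
    using that cut[of a "r - a"] join[of a "r - a"] by simp
  then have "(\<Sum>a=1..<r. (k * of_nat r) * pmul a (pmul (r - a) (pder r f)) mu +
                of_nat (a * (r - a)) * pmul r (pder a (pder (r - a) f)) mu) = 0" for r
    by (intro sum.neutral ballI) (simp only: mult_zero_right add_0)
  then have "jack_op k d f mu = 0"
    unfolding jack_op_def diag by simp
  with nz show False ..
qed

text \<open>The order on the fraction field extends that of \<open>rat poly\<close>, where the sign
  is that of the leading coefficient.\<close>

lemma param_pos: "0 < param"
proof -
  have "0 < ([:0, 1:] :: rat poly)" by (simp add: less_poly_def pos_poly_pCons)
  then show ?thesis by (simp add: param_def zero_less_Fract_iff)
qed

section \<open>The Jack scalar product and its positivity\<close>

definition jack_weight :: "nat multiset \<Rightarrow> ratfun" where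
  "jack_weight mu = of_nat (z_partition mu) * (1 / param) ^ size mu"

lemma jack_weight_pos: "is_partition mu \<Longrightarrow> 0 < jack_weight mu"
  by (simp add: jack_weight_def z_partition_pos param_pos)

lemma jack_weight_add_mset:
  "jack_weight (add_mset r mu) = of_nat (r * Suc (count mu r)) / param * jack_weight mu"
  by (simp add: jack_weight_def z_partition_add_mset)

definition jack_form :: "(nat multiset \<Rightarrow> ratfun) \<Rightarrow> (nat multiset \<Rightarrow> ratfun) \<Rightarrow> ratfun" where
  "jack_form f g = pairing f (\<lambda>mu. g mu * jack_weight mu)"

lemma jack_inner_eq: "jack_inner f g = jack_form (Poly_Mapping.lookup f) (Poly_Mapping.lookup g)"
  by (simp add: jack_inner_def jack_form_def pairing_def jack_weight_def keys.rep_eq mult.assoc)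

lemma jack_form_diff: "fin_supp f \<Longrightarrow> fin_supp g \<Longrightarrow> jack_form (\<lambda>mu. f mu - g mu) h = jack_form f h - jack_form g h"
  by (simp add: jack_form_def pairing_diff)

lemma jack_form_cmult: "fin_supp f \<Longrightarrow> jack_form (\<lambda>mu. c * f mu) h = c * jack_form f h"
  by (simp add: jack_form_def pairing_cmult)

lemma jack_form_commute: "fin_supp f \<Longrightarrow> fin_supp g \<Longrightarrow> jack_form f g = jack_form g f"
  unfolding jack_form_def by (rule pairing_weighted_commute)

text \<open>Nonzero squares are positive in the ordered field and so are the weights of partitions,
  so no cancellation can occur in the sum.\<close>

lemma jack_form_self_eq_0:
  assumes "homog d f" "jack_form f f = 0"
  shows "f mu = 0"
proof (rule ccontr)
  assume mu: "f mu \<noteq> 0"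
  have pos: "0 < f nu * (f nu * jack_weight nu)" if "f nu \<noteq> 0" for nu
  proof -
    have "0 < f nu * f nu" using that by (metis mult_eq_0_iff order_le_less zero_le_square)
    moreover have "0 < jack_weight nu"
      using that assms(1) by (intro jack_weight_pos) (simp add: homog_def)
    ultimately show ?thesis by (simp only: mult.assoc[symmetric] mult_pos_pos)
  qed
  have "0 < jack_form f f"
    unfolding jack_form_def pairing_def
    by (rule sum_pos2[of _ mu])
      (use bdd_wt_fin_supp[OF homog_imp_bdd_wt[OF assms(1)]] mu pos in \<open>auto simp: fin_supp_def intro: less_imp_le\<close>)
  with assms(2) show False by simp
qed

lemma homog_diff_cmult:
  "homog d f \<Longrightarrow> homog d g \<Longrightarrow> homog d (\<lambda>mu. f mu - c * g mu :: 'a::comm_ring_1)"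
  unfolding homog_def
proof (intro allI impI)
  fix mu
  assume "\<forall>mu. f mu \<noteq> 0 \<longrightarrow> is_partition mu \<and> sum_mset mu = d"
    "\<forall>mu. g mu \<noteq> 0 \<longrightarrow> is_partition mu \<and> sum_mset mu = d" "f mu - c * g mu \<noteq> 0"
  moreover from this(3) have "f mu \<noteq> 0 \<or> g mu \<noteq> 0" by auto
  ultimately show "is_partition mu \<and> sum_mset mu = d" by blast
qed

lemma homog_fin_supp: "homog d f \<Longrightarrow> fin_supp f"
  by (rule bdd_wt_fin_supp[OF homog_imp_bdd_wt])

text \<open>Reading the coefficient at \<open>e\<close> selects the monomial symmetric function of
  \<open>shape e\<close>, which turns unitriangularity into a statement about exponents.\<close>

lemma jack_coeff:
  assumes "is_jack_family J" "is_partition la"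
  shows "Poly_Mapping.lookup (realize N (Poly_Mapping.lookup (J la))) e \<noteq> 0 \<Longrightarrow>
      is_partition (shape e) \<and> dominated_by (shape e) la"
    and "size la \<le> N \<Longrightarrow> Poly_Mapping.lookup (realize N (Poly_Mapping.lookup (J la))) (expo la) = 1"
proof -
  obtain u where u: "restrict_vars N (J la) = monomial_sym N la +
           (\<Sum>mu | is_partition mu \<and> dominated_by mu la \<and> mu \<noteq> la.
              Const (u mu) * monomial_sym N mu)" for N
    using assms unfolding is_jack_family_def by blast
  have coeff: "Poly_Mapping.lookup (realize N (Poly_Mapping.lookup (J la))) e =
      Poly_Mapping.lookup (monomial_sym N la) e + (\<Sum>mu | is_partition mu \<and> dominated_by mu la \<and> mu \<noteq> la.
              u mu * Poly_Mapping.lookup (monomial_sym N mu) e)" for e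
    unfolding restrict_vars_eq[symmetric] u by (simp add: lookup_add lookup_sum lookup_Const_mult)
  show "is_partition (shape e) \<and> dominated_by (shape e) la"
    if nz: "Poly_Mapping.lookup (realize N (Poly_Mapping.lookup (J la))) e \<noteq> 0"
  proof (cases "shape e = la")
    case True
    with assms(2) show ?thesis by (simp add: dominated_by_refl)
  next
    case False
    then have "(\<Sum>mu | is_partition mu \<and> dominated_by mu la \<and> mu \<noteq> la.
              u mu * Poly_Mapping.lookup (monomial_sym N mu) e) \<noteq> 0"
      using nz by (simp add: coeff lookup_monomial_sym)
    then obtain mu where "is_partition mu" "dominated_by mu la"
        "u mu * Poly_Mapping.lookup (monomial_sym N mu) e \<noteq> 0"
      using sum.not_neutral_contains_not_neutral by (metis (no_types, lifting) mem_Collect_eq)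
    then show ?thesis by (auto simp: lookup_monomial_sym split: if_splits)
  qed
  show "Poly_Mapping.lookup (realize N (Poly_Mapping.lookup (J la))) (expo la) = 1" if "size la \<le> N"
  proof -
    have "(\<Sum>mu | is_partition mu \<and> dominated_by mu la \<and> mu \<noteq> la.
              u mu * Poly_Mapping.lookup (monomial_sym N mu) (expo la)) = 0"
      by (rule sum.neutral) (auto simp: lookup_monomial_sym shape_expo[OF assms(2)])
    then show ?thesis
      using that by (simp add: coeff lookup_monomial_sym shape_expo[OF assms(2)] keys_expo[OF assms(2)])
  qed
qed

text \<open>The definition controls degrees only through dominance of monomials. A coefficient at
  \<open>mu\<close> forces, by \<open>realize_nonzero_coeff\<close>, a monomial of the same weight,
  and its shape is dominated by \<open>la\<close>.\<close>

lemma homog_jack: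
  assumes J: "is_jack_family J" and la: "is_partition la"
  shows "homog (sum_mset la) (Poly_Mapping.lookup (J la))"
  unfolding homog_def
proof (intro allI impI)
  fix mu assume mu: "Poly_Mapping.lookup (J la) mu \<noteq> 0"
  have part: "is_partition nu" if "Poly_Mapping.lookup (J la) nu \<noteq> 0" for nu
    using J la that unfolding is_jack_family_def by (auto simp: in_keys_iff)
  have "fin_supp (Poly_Mapping.lookup (J la))" by (simp add: fin_supp_def)
  then obtain nu where nu: "Poly_Mapping.lookup (J la) nu \<noteq> 0" "sum_mset nu = sum_mset mu"
    "\<forall>N\<ge>size nu. Poly_Mapping.lookup (realize N (Poly_Mapping.lookup (J la))) (expo nu) \<noteq> 0"
    using realize_nonzero_coeff[where f = "Poly_Mapping.lookup (J la)", OF _ part mu] by blast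
  have "dominated_by nu la"
    using jack_coeff(1)[OF J la nu(3)[rule_format, OF order_refl]] by (simp add: shape_expo part[OF nu(1)])
  with nu(2) part[OF mu] show "is_partition mu \<and> sum_mset mu = sum_mset la"
    by (simp add: dominated_by_def)
qed

text \<open>For \<open>Q\<close> closed downwards, the \<open>J mu\<close> with \<open>mu\<close> in
  \<open>Q\<close> span the homogeneous \<open>f\<close> whose decreasing exponents belong to
  \<open>Q\<close>: subtracting a multiple of \<open>J mu\<close> for a maximal \<open>mu\<close>
  clears \<open>mu\<close>. Orthogonality to \<open>h\<close> is carried through this induction. In
  degree \<open>d\<close>, \<open>d\<close> variables suffice because a partition of
  \<open>d\<close> has at most \<open>d\<close> parts.\<close>

lemma jack_form_span:
  assumes J: "is_jack_family J" and "finite Q"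
    and Q: "\<And>mu. mu \<in> Q \<Longrightarrow> is_partition mu \<and> sum_mset mu = d"
    and down: "\<And>mu nu. mu \<in> Q \<Longrightarrow> is_partition nu \<Longrightarrow> dominated_by nu mu \<Longrightarrow> nu \<in> Q"
    and f: "homog d f"
    and supp: "\<And>mu. is_partition mu \<Longrightarrow> sum_mset mu = d \<Longrightarrow>
      Poly_Mapping.lookup (realize d f) (expo mu) \<noteq> 0 \<Longrightarrow> mu \<in> Q"
    and h: "\<And>mu. mu \<in> Q \<Longrightarrow> jack_form (Poly_Mapping.lookup (J mu)) h = 0"
  shows "jack_form f h = 0"
  using assms(2-)
proof (induction Q arbitrary: f rule: finite_psubset_induct)
  case (psubset Q)
  note Q = psubset.prems(1) and down = psubset.prems(2) and f = psubset.prems(3)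
    and supp = psubset.prems(4) and h = psubset.prems(5)
  have fin: "fin_supp f" by (rule homog_fin_supp[OF f])
  show ?case
  proof (cases "Q = {}")
    case True
    have "f mu = 0" for mu
    proof (rule ccontr)
      assume mu: "f mu \<noteq> 0"
      have part: "is_partition nu \<and> sum_mset nu = d" if "f nu \<noteq> 0" for nu
        using f that by (simp add: homog_def)
      obtain nu where nu: "f nu \<noteq> 0" "sum_mset nu = sum_mset mu"
        "\<forall>N\<ge>size nu. Poly_Mapping.lookup (realize N f) (expo nu) \<noteq> 0"
        using realize_nonzero_coeff[where f = f, OF fin conjunct1[OF part] mu] by blast
      have "size nu \<le> d" using size_le_sum_mset part[OF nu(1)] by blast
      from supp[OF _ _ nu(3)[rule_format, OF this]] part[OF nu(1)] True show False by simp
    qed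
    then show ?thesis by (simp add: jack_form_def pairing_def)
  next
    case False
    \<comment> \<open>Maximality keeps \<open>Q - {mu}\<close> closed downwards, since nothing left
      in it dominates \<open>mu\<close>.\<close>
    have "\<exists>mu\<in>Q. \<forall>nu\<in>Q. nu \<noteq> mu \<longrightarrow> \<not> (dominated_by mu nu \<and> mu \<noteq> nu)"
      by (rule Finite_Set.bex_max_element)
        (use psubset.hyps False Q in \<open>auto simp: asymp_on_def transp_on_def
          intro: dominated_by_trans dest: dominated_by_antisym\<close>)
    then obtain mu where mu: "mu \<in> Q" "\<And>nu. nu \<in> Q \<Longrightarrow> dominated_by mu nu \<Longrightarrow> nu = mu" by blast
    have pmu: "is_partition mu" "sum_mset mu = d" using Q mu(1) by auto
    \<comment> \<open>\<open>J mu\<close> has coefficient 1 at \<open>expo mu\<close>, so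
      subtracting \<open>c\<close> times it clears that coefficient; its other decreasing exponents
      are dominated by \<open>mu\<close> and stay in \<open>Q\<close>.\<close>
    define c where "c = Poly_Mapping.lookup (realize d f) (expo mu)"
    define j where "j = Poly_Mapping.lookup (J mu)"
    define f' where "f' = (\<lambda>nu. f nu - c * j nu)"
    have j: "homog d j" unfolding j_def pmu(2)[symmetric] by (rule homog_jack[OF J pmu(1)])
    have f': "homog d f'" unfolding f'_def by (rule homog_diff_cmult[OF f j])
    have coeff: "Poly_Mapping.lookup (realize d f') e =
        Poly_Mapping.lookup (realize d f) e - c * Poly_Mapping.lookup (realize d j) e" for e
      unfolding lookup_realize f'_def
      using fin homog_fin_supp[OF j] by (simp add: pairing_diff pairing_cmult fin_supp_cmult)
    have "size mu \<le> d" using size_le_sum_mset[OF pmu(1)] pmu(2) by simp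
    then have c0: "Poly_Mapping.lookup (realize d f') (expo mu) = 0"
      using jack_coeff(2)[OF J pmu(1)] by (simp add: coeff c_def j_def)
    have "jack_form f' h = 0"
    proof (rule psubset.IH[of "Q - {mu}"])
      show "Q - {mu} \<subset> Q" using mu(1) by blast
      show "is_partition nu \<and> sum_mset nu = d" if "nu \<in> Q - {mu}" for nu
        using Q that by blast
      show "rho \<in> Q - {mu}" if "nu \<in> Q - {mu}" "is_partition rho" "dominated_by rho nu" for nu rho
        using down[of nu rho] mu(2)[of nu] that by blast
      show "nu \<in> Q - {mu}" if "is_partition nu" "sum_mset nu = d"
        "Poly_Mapping.lookup (realize d f') (expo nu) \<noteq> 0" for nu
      proof -
        have "Poly_Mapping.lookup (realize d f) (expo nu) \<noteq> 0 \<or> Poly_Mapping.lookup (realize d j) (expo nu) \<noteq> 0"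
          using that(3) by (auto simp: coeff)
        then have "nu \<in> Q"
        proof
          assume "Poly_Mapping.lookup (realize d j) (expo nu) \<noteq> 0"
          then have "dominated_by nu mu"
            unfolding j_def using jack_coeff(1)[OF J pmu(1)] shape_expo[OF that(1)] by metis
          then show ?thesis using down mu(1) that(1) by blast
        qed (rule supp[OF that(1,2)])
        with that(3) c0 show ?thesis by auto
      qed
      show "jack_form (Poly_Mapping.lookup (J nu)) h = 0" if "nu \<in> Q - {mu}" for nu
        using h that by blast
    qed (rule f')
    then show ?thesis
      using h[OF mu(1)] fin homog_fin_supp[OF j]
      by (simp add: f'_def jack_form_diff jack_form_cmult fin_supp_cmult j_def[symmetric])
  qed
qed

text \<open>For each \<open>l\<close>, the monomials of \<open>J la\<close> have degree in the first
  \<open>l\<close> variables at most the \<open>l\<close>-th partial sum of \<open>la\<close>.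
  \<open>jack_op\<close> keeps this bound, and at \<open>expo mu\<close> the degree is the partial
  sum of \<open>mu\<close>.\<close>

lemma jack_op_triangular:
  assumes J: "is_jack_family J" and la: "is_partition la" and mu: "is_partition mu" "sum_mset mu = sum_mset la"
    and nz: "Poly_Mapping.lookup (realize N (jack_op k d (Poly_Mapping.lookup (J la)))) (expo mu) \<noteq> 0"
    and d: "d = sum_mset la"
  shows "dominated_by mu la"
  unfolding dominated_by_def
proof (intro conjI allI mu(2))
  fix l
  have "wt_below l (sum_list (take l (parts_desc la))) (realize N (Poly_Mapping.lookup (J la)))"
    unfolding wt_below_def
  proof (intro allI impI)
    fix e assume "Poly_Mapping.lookup (realize N (Poly_Mapping.lookup (J la))) e \<noteq> 0"
    then have "dominated_by (shape e) la" using jack_coeff(1)[OF J la] by blast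
    then show "(\<Sum>i<l. Poly_Mapping.lookup e i) \<le> sum_list (take l (parts_desc la))"
      unfolding dominated_by_def using sum_le_take_shape[of e l] order_trans by blast
  qed
  from wt_below_jack_op[OF homog_imp_bdd_wt[OF homog_jack[OF J la]] this, folded d] nz
  show "sum_list (take l (parts_desc mu)) \<le> sum_list (take l (parts_desc la))"
    unfolding wt_below_def sum_expo[symmetric] by blast
qed

text \<open>The defect \<open>g\<close> of the eigenvalue equation lies in the span of the
  \<open>J nu\<close> strictly below \<open>la\<close> and is orthogonal to each of them, so it is
  orthogonal to itself and vanishes by definiteness.\<close>

lemma jack_eigen:
  assumes J: "is_jack_family J" and la: "is_partition la"
  shows "\<exists>c. \<forall>mu. jack_op param (sum_mset la) (Poly_Mapping.lookup (J la)) mu =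
    c * Poly_Mapping.lookup (J la) mu"
proof -
  define d where "d = sum_mset la"
  define j where "j mu = Poly_Mapping.lookup (J mu)" for mu
  define L where "L = jack_op param d"
  \<comment> \<open>\<open>J la\<close> has leading coefficient 1, so this candidate eigenvalue
    clears the leading coefficient of \<open>g\<close>.\<close>
  define c where "c = Poly_Mapping.lookup (realize d (L (j la))) (expo la)"
  define g where "g mu = L (j la) mu - c * j la mu" for mu
  have hom: "homog d (j mu)" if "is_partition mu" "sum_mset mu = d" for mu
    using homog_jack[OF J that(1)] that(2) by (simp add: j_def)
  have homL: "homog d (L (j mu))" if "is_partition mu" "sum_mset mu = d" for mu
    unfolding L_def by (rule homog_jack_op[OF hom[OF that]])
  have la': "is_partition la" "sum_mset la = d" using la by (auto simp: d_def)
  note fj = homog_fin_supp[OF hom[OF la']] and fL = homog_fin_supp[OF homL[OF la']]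
  have hg: "homog d g"
    unfolding g_def by (rule homog_diff_cmult[OF homL[OF la'] hom[OF la']])
  have finQ: "finite {mu. is_partition mu \<and> dominated_by mu nu \<and> P mu}" for nu P
    by (rule finite_subset[OF _ finite_partitions[of "sum_mset nu"]]) (auto simp: dominated_by_def)
  have tri: "dominated_by mu nu"
    if "is_partition nu" "sum_mset nu = d" "is_partition mu" "sum_mset mu = d"
      "Poly_Mapping.lookup (realize d (L (j nu))) (expo mu) \<noteq> 0" for mu nu
    by (rule jack_op_triangular[OF J that(1,3) _ that(5)[unfolded L_def j_def] that(2)[symmetric]])
      (simp only: that)
  have orth: "jack_form (j mu) (j nu) = 0" if "is_partition mu" "is_partition nu" "mu \<noteq> nu" for mu nu
  proof -
    have "jack_inner (J mu) (J nu) = 0"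
      using J that unfolding is_jack_family_def by blast
    then show ?thesis unfolding jack_inner_eq j_def .
  qed
  \<comment> \<open>Triangularity puts \<open>L (j nu)\<close> in the span of the
    \<open>J mu\<close> with \<open>mu\<close> dominated by \<open>nu\<close>, all orthogonal to
    \<open>J la\<close>; self-adjointness then moves \<open>L\<close> onto
    \<open>j la\<close>.\<close>
  have below: "jack_form (j nu) g = 0" if nu: "is_partition nu" "dominated_by nu la" "nu \<noteq> la" for nu
  proof -
    have nu': "sum_mset nu = d" using nu by (simp add: dominated_by_def d_def)
    have "jack_form (L (j nu)) (j la) = 0"
    proof (rule jack_form_span[OF J finQ[of nu "\<lambda>_. True"]])
      show "homog d (L (j nu))" by (rule homL[OF nu(1) nu'])
      show "is_partition mu \<and> sum_mset mu = d"
        if "mu \<in> {mu. is_partition mu \<and> dominated_by mu nu \<and> True}" for mu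
        using that nu' by (simp add: dominated_by_def)
      show "mu \<in> {mu. is_partition mu \<and> dominated_by mu nu \<and> True}"
        if "is_partition mu" "sum_mset mu = d" "Poly_Mapping.lookup (realize d (L (j nu))) (expo mu) \<noteq> 0" for mu
        using tri[OF nu(1) nu' that] that(1) by simp
      show "rho \<in> {mu. is_partition mu \<and> dominated_by mu nu \<and> True}"
        if "mu \<in> {mu. is_partition mu \<and> dominated_by mu nu \<and> True}" "is_partition rho"
          "dominated_by rho mu" for mu rho
        using that dominated_by_trans by blast
      fix mu assume mu: "mu \<in> {mu. is_partition mu \<and> dominated_by mu nu \<and> True}"
      have "mu \<noteq> la"
        using mu nu la dominated_by_antisym by blast
      then show "jack_form (Poly_Mapping.lookup (J mu)) (j la) = 0"
        using orth[of mu la] mu la by (simp add: j_def)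
    qed
    moreover have "jack_form (L (j nu)) (j la) = jack_form (L (j la)) (j nu)"
      unfolding jack_form_def L_def
      by (rule jack_op_adjoint[OF _ homog_fin_supp[OF hom[OF nu(1) nu']] fj jack_weight_add_mset])
        (use param_pos in simp)
    ultimately have "jack_form g (j nu) = 0"
      unfolding g_def using orth[of la nu] la nu fj fL
      by (simp add: jack_form_diff jack_form_cmult fin_supp_cmult)
    then show ?thesis
      using jack_form_commute[OF homog_fin_supp[OF hg] homog_fin_supp[OF hom[OF nu(1) nu']]] by simp
  qed
  have "size la \<le> d" using size_le_sum_mset[OF la] by (simp add: d_def)
  have coeff: "Poly_Mapping.lookup (realize d g) e =
        Poly_Mapping.lookup (realize d (L (j la))) e - c * Poly_Mapping.lookup (realize d (j la)) e" for e
    unfolding lookup_realize g_def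
    using fj fL by (simp add: pairing_diff pairing_cmult fin_supp_cmult)
  have g0: "Poly_Mapping.lookup (realize d g) (expo la) = 0"
    using jack_coeff(2)[OF J la \<open>size la \<le> d\<close>] by (simp add: coeff c_def j_def)
  have "jack_form g g = 0"
  proof (rule jack_form_span[OF J finQ[of la "\<lambda>mu. mu \<noteq> la"]])
    show "homog d g" by (rule hg)
    show "mu \<in> {mu. is_partition mu \<and> dominated_by mu la \<and> mu \<noteq> la}"
      if "is_partition mu" "sum_mset mu = d" "Poly_Mapping.lookup (realize d g) (expo mu) \<noteq> 0" for mu
    proof -
      have "Poly_Mapping.lookup (realize d (L (j la))) (expo mu) \<noteq> 0 \<or>
          Poly_Mapping.lookup (realize d (j la)) (expo mu) \<noteq> 0"
        using that(3) by (auto simp: coeff)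
      then have "dominated_by mu la"
        using tri[OF la' that(1,2)] jack_coeff(1)[OF J la, of d "expo mu"] shape_expo[OF that(1)]
        by (auto simp: j_def)
      with that g0 show ?thesis by auto
    qed
    show "jack_form (Poly_Mapping.lookup (J mu)) g = 0"
      if "mu \<in> {mu. is_partition mu \<and> dominated_by mu la \<and> mu \<noteq> la}" for mu
      using below[of mu] that by (simp add: j_def)
    show "nu \<in> {mu. is_partition mu \<and> dominated_by mu la \<and> mu \<noteq> la}"
      if "mu \<in> {mu. is_partition mu \<and> dominated_by mu la \<and> mu \<noteq> la}" "is_partition nu"
        "dominated_by nu mu" for mu nu
      using that la dominated_by_trans dominated_by_antisym by blast
  qed (simp add: dominated_by_def d_def)
  then have "g mu = 0" for mu by (rule jack_form_self_eq_0[OF hg])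
  then show ?thesis
    by (intro exI[of _ c]) (simp add: g_def L_def j_def d_def)
qed

text \<open>The eigenvalue is eliminated before specialising: in the identity of the products of
  \<open>f nu\<close> and \<open>f mu\<close> with each other's images, every factor specialises,
  and division by a nonzero \<open>g nu\<close> gives the new eigenvalue.\<close>

lemma specialized_jack_eigen:
  assumes eig: "\<And>mu. jack_op param d f mu = c * f mu" and spec: "\<And>mu. specializes k (f mu) (g mu)"
  shows "\<exists>c'. \<forall>mu. jack_op k d g mu = c' * g mu"
proof (cases "\<exists>nu. g nu \<noteq> 0")
  case True
  then obtain nu where nu: "g nu \<noteq> 0" by blast
  have "g nu * jack_op k d g mu = g mu * jack_op k d g nu" for mu
  proof (rule specializes_unique)
    show "specializes k (f nu * jack_op param d f mu) (g nu * jack_op k d g mu)"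
      by (intro specializes_mult specializes_jack_op spec)
    have "f nu * jack_op param d f mu = f mu * jack_op param d f nu"
      by (simp add: eig mult.left_commute)
    then show "specializes k (f nu * jack_op param d f mu) (g mu * jack_op k d g nu)"
      by (simp only:) (intro specializes_mult specializes_jack_op spec)
  qed
  then show ?thesis
    using nu by (intro exI[of _ "jack_op k d g nu / g nu"]) (simp add: field_simps)
next
  case False
  then have g: "g = (\<lambda>_. 0)" by auto
  have "pmul r (\<lambda>_. 0 :: complex) = (\<lambda>_. 0)" "pder r (\<lambda>_. 0 :: complex) = (\<lambda>_. 0)" for r
    by (auto simp: pmul_def pder_def)
  then show ?thesis unfolding g by (intro exI[of _ 0]) (simp add: jack_op_def)
qed

theorem theorem1:
  fixes n m :: nat
    and k :: complex
    and J :: "nat multiset \<Rightarrow> ratfun symfun"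
    and la :: "nat multiset"
  assumes "is_jack_family J"
    and "is_partition la"
    and "k \<noteq> 0"
    and "\<And>mu. regular_at (Poly_Mapping.lookup (J la) mu) k"
  shows "is_eigenfunction n m (calogero_super n m k) (super_jack n m k (J la))"
proof -
  define d where "d = sum_mset la"
  define g where "g mu = eval_ratfun (Poly_Mapping.lookup (J la) mu) k" for mu
  have spec: "specializes k (Poly_Mapping.lookup (J la) mu) (g mu)" for mu
    unfolding g_def by (rule specializes_eval_ratfun[OF assms(4)])
  obtain c where "\<forall>mu. jack_op param d (Poly_Mapping.lookup (J la)) mu = c * Poly_Mapping.lookup (J la) mu"
    unfolding d_def using jack_eigen[OF assms(1,2)] by blast
  then obtain c' where c': "\<forall>mu. jack_op k d g mu = c' * g mu"
    using specialized_jack_eigen[of d "Poly_Mapping.lookup (J la)" c k g, OF _ spec] by blast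
  \<comment> \<open>\<open>eval_ratfun 0 k\<close> is 0, so \<open>g\<close> vanishes outside the
    support of \<open>J la\<close> and inherits its homogeneity.\<close>
  have "g mu = 0" if "Poly_Mapping.lookup (J la) mu = 0" for mu
    unfolding g_def that by (rule eval_ratfun_eq[OF specializes_0])
  then have g: "homog d g"
    using homog_jack[OF assms(1,2)] unfolding homog_def d_def by blast
  have "jack_op k d g = (\<lambda>mu. c' * g mu)" by (rule ext) (rule c'[rule_format])
  then have "super_eval n m k (jack_op k d g) x y = c' * super_eval n m k g x y" for x y
    by (simp add: super_eval_def ev_def pairing_cmult homog_fin_supp[OF g])
  then have "calogero_super n m k (super_eval n m k g) x y =
      (c' + (k * of_nat n - of_nat m) * of_nat d) * super_eval n m k g x y"
    if "regular_point n m x y" for x y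
    by (simp add: calogero_super_eval[OF g assms(3) that] distrib_right)
  then show ?thesis
    unfolding is_eigenfunction_def super_jack_eq g_def[symmetric] by blast
qed

end
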